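(* Let $V$ be a vector space of dimension $\ell$ over a field $K$ (of arbitrary characteristic), and let $\Delta=(\alpha_1,\dots,\alpha_n)$ be a sequence of elements of the dual space $V^*$ which spans $V^*$ (zero forms and scalar multiples among the $\alpha_i$ are allowed). Let $E=\{1,\dots,n\}$ and let $M(\Delta)$ be the matroid on $E$ whose rank function is $r(S)=\dim_K \operatorname{span}\{\alpha_i : i\in S\}$. For $S\subseteq E$ put $\alpha_S=\prod_{i\in S}\alpha_i\in\operatorname{Sym}(V^* )$. For $0\le j\le k\le n$ let $P(\Delta)_{j,k}$ be the $K$-span in $\operatorname{Sym}(V^* )$ of those $\alpha_S$ such that $r(E-S)=j$ and $|E-S|=k$. Then the Tutte polynomial of $M(\Delta)$ is \[ T(M(\Delta);x,y)=\sum_{0\le j\le k\le n}(x-1)^{\ell-j}\,y^{k-j}\,\dim_K P(\Delta)_{j,k}. \]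
   Context: $\operatorname{Sym}(V^* )$ is the symmetric algebra of $V^*$, i.e. the polynomial functions on $V$. The Tutte polynomial of a matroid is the standard one (e.g. $T(M;x,y)=\sum_{A\subseteq E}(x-1)^{r(E)-r(A)}(y-1)^{|A|-r(A)}$). *)

theory Defs
  imports
    "HOL-Computational_Algebra.Polynomial"
    "HOL-Library.Poly_Mapping"
    "HOL-Library.Function_Algebras"
    "HOL-Algebra.Embedded_Algebras"
begin

section \<open>Matroids and the Tutte polynomial\<close>

locale matroid_rank =
  fixes E :: "'e set" and r :: "'e set \<Rightarrow> nat"
  assumes finite_ground: "finite E"
    and rank_le_card: "A \<subseteq> E \<Longrightarrow> r A \<le> card A"
    and rank_mono: "A \<subseteq> B \<Longrightarrow> B \<subseteq> E \<Longrightarrow> r A \<le> r B"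
    and rank_submodular:
      "A \<subseteq> E \<Longrightarrow> B \<subseteq> E \<Longrightarrow> r (A \<union> B) + r (A \<inter> B) \<le> r A + r B"

text \<open>The ring \<open>\<int>[x,y]\<close> is \<^typ>\<open>int poly poly\<close>; the outer variable is \<open>y\<close>.\<close>

definition poly_x :: "int poly poly" where
  "poly_x = [:[:0, 1:]:]"

definition poly_y :: "int poly poly" where
  "poly_y = [:0, 1:]"

text \<open>The matroid with ground set \<open>E\<close> and rank function \<open>r\<close>; the truncated subtractions are
  exact because \<open>r A \<le> r E\<close> and \<open>r A \<le> card A\<close> in a matroid.\<close>

definition tutte_poly :: "'e set \<Rightarrow> ('e set \<Rightarrow> nat) \<Rightarrow> int poly poly" where
  "tutte_poly E r =
     (\<Sum>A\<in>Pow E. (poly_x - 1) ^ (r E - r A) * (poly_y - 1) ^ (card A - r A))"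


section \<open>Linear forms and the matroid they represent\<close>

definition fun_scale :: "'k::field \<Rightarrow> ('v \<Rightarrow> 'k) \<Rightarrow> 'v \<Rightarrow> 'k" where
  "fun_scale c f = (\<lambda>x. c * f x)"

interpretation fun_vs: vector_space "fun_scale :: 'k::field \<Rightarrow> ('v \<Rightarrow> 'k) \<Rightarrow> 'v \<Rightarrow> 'k"
  by unfold_locales (auto simp: fun_scale_def fun_eq_iff algebra_simps)

definition dual_space :: "('k::field \<Rightarrow> 'v::ab_group_add \<Rightarrow> 'v) \<Rightarrow> ('v \<Rightarrow> 'k) set" where
  "dual_space scale = {f. Vector_Spaces.linear scale (*) f}"

text \<open>The rank function of the matroid represented by a sequence of forms.\<close>

definition form_rank :: "(nat \<Rightarrow> 'v \<Rightarrow> 'k::field) \<Rightarrow> nat set \<Rightarrow> nat" where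
  "form_rank \<alpha> S = fun_vs.dim (fun_vs.span (\<alpha> ` S))"

lemma matroid_form_rank: "matroid_rank {1..n} (form_rank \<alpha>)"
proof
  show "finite {1..n}" by simp
next
  fix A assume "A \<subseteq> {1..n}"
  then have "finite A" by (rule finite_subset) simp
  then show "form_rank \<alpha> A \<le> card A"
    unfolding form_rank_def fun_vs.dim_span
    by (meson card_image_le finite_imageI fun_vs.dim_le_card fun_vs.span_superset le_trans)
next
  fix A B assume AB: "A \<subseteq> B" "B \<subseteq> {1..n}"
  then have fin: "finite B" using finite_subset by blast
  obtain J where J: "J \<subseteq> \<alpha> ` B" "fun_vs.independent J" "\<alpha> ` B \<subseteq> fun_vs.span J"
    using fun_vs.maximal_independent_subset by blast
  have "fun_vs.dim (\<alpha> ` A) \<le> card J"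
    by (rule fun_vs.dim_le_card) (use AB J(3) finite_subset[OF J(1)] fin in auto)
  also have "card J = fun_vs.dim (\<alpha> ` B)"
    using fun_vs.basis_card_eq_dim J by blast
  finally show "form_rank \<alpha> A \<le> form_rank \<alpha> B"
    by (simp add: form_rank_def)
next
  fix A B assume AB: "A \<subseteq> {1..n}" "B \<subseteq> {1..n}"
  then have fin: "finite A" "finite B" using finite_subset by blast+
  obtain I where I: "I \<subseteq> \<alpha> ` (A \<inter> B)" "fun_vs.independent I" "\<alpha> ` (A \<inter> B) \<subseteq> fun_vs.span I"
    using fun_vs.maximal_independent_subset by blast
  obtain J where J: "J \<subseteq> \<alpha> ` A" "fun_vs.independent J" "\<alpha> ` A \<subseteq> fun_vs.span J"
    using fun_vs.maximal_independent_subset by blast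
  have "I \<subseteq> \<alpha> ` B" using I by blast
  then obtain L where L: "I \<subseteq> L" "L \<subseteq> \<alpha> ` B" "fun_vs.independent L" "\<alpha> ` B \<subseteq> fun_vs.span L"
    using fun_vs.maximal_independent_subset_extend[OF _ I(2)] by metis
  have finJL: "finite J" "finite L"
    using finite_subset[OF J(1)] finite_subset[OF L(2)] fin by simp_all
  have "I \<subseteq> fun_vs.span J" using I(1) J(3) by blast
  then have "L \<subseteq> fun_vs.span (J \<union> (L - I))"
    using fun_vs.span_superset[of "J \<union> (L - I)"] fun_vs.span_mono[of J "J \<union> (L - I)"] by blast
  then have "\<alpha> ` B \<subseteq> fun_vs.span (J \<union> (L - I))"
    using L(4) fun_vs.span_minimal[OF _ fun_vs.subspace_span] by blast
  moreover have "\<alpha> ` A \<subseteq> fun_vs.span (J \<union> (L - I))"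
    using J(3) fun_vs.span_mono[of J "J \<union> (L - I)"] by blast
  ultimately have "fun_vs.dim (\<alpha> ` (A \<union> B)) \<le> card (J \<union> (L - I))"
    by (intro fun_vs.dim_le_card) (use finJL in \<open>auto simp: image_Un\<close>)
  also have "\<dots> \<le> card J + (card L - card I)"
    using card_Un_le[of J "L - I"] card_Diff_subset[of I L] L(1) finJL(2)
      finite_subset[OF L(1) finJL(2)] by simp
  finally have *: "fun_vs.dim (\<alpha> ` (A \<union> B)) \<le> card J + (card L - card I)" .
  have "card I \<le> card L" using L(1) finJL(2) by (rule card_mono[rotated])
  moreover have "card I = fun_vs.dim (\<alpha> ` (A \<inter> B))" "card J = fun_vs.dim (\<alpha> ` A)"
    "card L = fun_vs.dim (\<alpha> ` B)"
    by (rule fun_vs.basis_card_eq_dim; fact I J L)+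
  ultimately show
    "form_rank \<alpha> (A \<union> B) + form_rank \<alpha> (A \<inter> B) \<le> form_rank \<alpha> A + form_rank \<alpha> B"
    using * by (simp add: form_rank_def)
qed


section \<open>The symmetric algebra\<close>

text \<open>For a subspace \<open>W\<close> of a \<open>K\<close>-vector space with scalar multiplication \<open>s\<close>, \<open>Sym(W)\<close> is the
  quotient of the polynomial algebra \<open>K[X(w) | w \<in> W]\<close>, with one indeterminate per vector, by the
  ideal that makes \<open>w \<mapsto> X(w)\<close> linear.  It is a formal object: over a finite field its elements
  are not determined by their values as functions.  A polynomial is a finitely supported map from
  exponent vectors \<^typ>\<open>'w \<Rightarrow>\<^sub>0 nat\<close> to coefficients.\<close>

type_synonym ('w, 'k) mpoly = "('w \<Rightarrow>\<^sub>0 nat) \<Rightarrow>\<^sub>0 'k"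

definition mp_const :: "'k::field \<Rightarrow> ('w, 'k) mpoly" where
  "mp_const c = Poly_Mapping.single 0 c"

definition mp_var :: "'w \<Rightarrow> ('w, 'k::field) mpoly" where
  "mp_var w = Poly_Mapping.single (Poly_Mapping.single w 1) 1"

definition mp_ring :: "'w set \<Rightarrow> ('w, 'k::field) mpoly ring" where
  "mp_ring W =
     \<lparr>carrier = {p. \<forall>m \<in> Poly_Mapping.keys p. Poly_Mapping.keys m \<subseteq> W},
      mult = (*), one = 1, zero = 0, add = (+)\<rparr>"

definition sym_relations ::
    "('k::field \<Rightarrow> 'w::ab_group_add \<Rightarrow> 'w) \<Rightarrow> 'w set \<Rightarrow> ('w, 'k) mpoly set" where
  "sym_relations s W =
     {mp_var (u + w) - mp_var u - mp_var w | u w. u \<in> W \<and> w \<in> W} \<union>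
     {mp_var (s c w) - mp_const c * mp_var w | c w. w \<in> W}"

definition sym_ideal ::
    "('k::field \<Rightarrow> 'w::ab_group_add \<Rightarrow> 'w) \<Rightarrow> 'w set \<Rightarrow> ('w, 'k) mpoly set" where
  "sym_ideal s W = genideal (mp_ring W) (sym_relations s W)"

definition Sym ::
    "('k::field \<Rightarrow> 'w::ab_group_add \<Rightarrow> 'w) \<Rightarrow> 'w set \<Rightarrow> ('w, 'k) mpoly set ring" where
  "Sym s W = mp_ring W Quot sym_ideal s W"

text \<open>The canonical map \<open>W \<rightarrow> Sym(W)\<close> and the copy of the ground field inside \<open>Sym(W)\<close>, which
  supplies its \<open>K\<close>-vector space structure.\<close>

definition sym_inc ::
    "('k::field \<Rightarrow> 'w::ab_group_add \<Rightarrow> 'w) \<Rightarrow> 'w set \<Rightarrow> 'w \<Rightarrow> ('w, 'k) mpoly set" where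
  "sym_inc s W w = sym_ideal s W +>\<^bsub>mp_ring W\<^esub> mp_var w"

definition sym_scalars ::
    "('k::field \<Rightarrow> 'w::ab_group_add \<Rightarrow> 'w) \<Rightarrow> 'w set \<Rightarrow> ('w, 'k) mpoly set set" where
  "sym_scalars s W = range (\<lambda>c. sym_ideal s W +>\<^bsub>mp_ring W\<^esub> mp_const c)"

lemma mp_ring_simps:
  "p \<in> carrier (mp_ring W) \<longleftrightarrow> (\<forall>m \<in> Poly_Mapping.keys p. Poly_Mapping.keys m \<subseteq> W)"
  "p \<otimes>\<^bsub>mp_ring W\<^esub> q = p * q" "\<one>\<^bsub>mp_ring W\<^esub> = 1"
  "p \<oplus>\<^bsub>mp_ring W\<^esub> q = p + q" "\<zero>\<^bsub>mp_ring W\<^esub> = 0"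
  by (simp_all add: mp_ring_def)

lemma mp_ring_cring: "cring (mp_ring W :: ('w, 'k::field) mpoly ring)"
proof (rule cringI)
  let ?R = "mp_ring W :: ('w, 'k) mpoly ring"
  show "abelian_group ?R"
  proof (rule abelian_groupI)
    fix x y assume "x \<in> carrier ?R" "y \<in> carrier ?R"
    then show "x \<oplus>\<^bsub>?R\<^esub> y \<in> carrier ?R"
      using Poly_Mapping.keys_add[of x y] by (auto simp: mp_ring_simps)
  next
    fix x assume "x \<in> carrier ?R"
    then have "- x \<in> carrier ?R" "- x \<oplus>\<^bsub>?R\<^esub> x = \<zero>\<^bsub>?R\<^esub>" by (simp_all add: mp_ring_simps)
    then show "\<exists>y\<in>carrier ?R. y \<oplus>\<^bsub>?R\<^esub> x = \<zero>\<^bsub>?R\<^esub>" by blast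
  qed (auto simp: mp_ring_simps ac_simps)
  show "comm_monoid ?R"
  proof (rule comm_monoidI)
    fix x y assume *: "x \<in> carrier ?R" "y \<in> carrier ?R"
    show "x \<otimes>\<^bsub>?R\<^esub> y \<in> carrier ?R"
    proof (unfold mp_ring_simps, intro ballI)
      fix m assume "m \<in> Poly_Mapping.keys (x * y)"
      then obtain a b where ab: "m = a + b" "a \<in> Poly_Mapping.keys x" "b \<in> Poly_Mapping.keys y"
        using Poly_Mapping.keys_mult[of x y] by blast
      with * show "Poly_Mapping.keys m \<subseteq> W"
        using Poly_Mapping.keys_add[of a b] unfolding mp_ring_simps by blast
    qed
  qed (auto simp: mp_ring_simps ac_simps)
qed (auto simp: mp_ring_simps distrib_right)

lemma mp_ring_minus: "x \<in> carrier (mp_ring W) \<Longrightarrow> \<ominus>\<^bsub>mp_ring W\<^esub> x = - x"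
proof -
  assume x: "x \<in> carrier (mp_ring W)"
  interpret cring "mp_ring W" by (rule mp_ring_cring)
  show ?thesis
    by (rule minus_equality) (use x in \<open>auto simp: mp_ring_simps\<close>)
qed

lemma mp_var_closed: "w \<in> W \<Longrightarrow> mp_var w \<in> carrier (mp_ring W)"
  by (simp add: mp_var_def mp_ring_simps)

lemma mp_const_closed: "mp_const c \<in> carrier (mp_ring W)"
  by (simp add: mp_const_def mp_ring_simps)

context
  fixes s :: "'k::field \<Rightarrow> 'w::ab_group_add \<Rightarrow> 'w" and W :: "'w set"
  assumes s: "vector_space s" and W: "module.subspace s W"
begin

lemma sym_relations_closed: "sym_relations s W \<subseteq> carrier (mp_ring W)"
proof -
  interpret vector_space s by (rule s)
  interpret R: cring "mp_ring W :: ('w, 'k) mpoly ring" by (rule mp_ring_cring)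
  have d: "p - q \<in> carrier (mp_ring W)"
    if "p \<in> carrier (mp_ring W)" "q \<in> carrier (mp_ring W)" for p q :: "('w, 'k) mpoly"
    using R.minus_closed[OF that] that
    by (simp add: a_minus_def mp_ring_minus mp_ring_simps(4))
  have m: "p * q \<in> carrier (mp_ring W)"
    if "p \<in> carrier (mp_ring W)" "q \<in> carrier (mp_ring W)" for p q :: "('w, 'k) mpoly"
    using R.m_closed[OF that] by (simp add: mp_ring_simps(2))
  show ?thesis
    using W unfolding sym_relations_def subspace_def
    by (auto intro!: d m mp_var_closed mp_const_closed)
qed

lemma sym_ideal_ideal: "ideal (sym_ideal s W) (mp_ring W)"
  unfolding sym_ideal_def
  by (rule ring.genideal_ideal[OF cring.axioms(1)[OF mp_ring_cring] sym_relations_closed])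

lemma Sym_cring: "cring (Sym s W)"
  unfolding Sym_def by (rule ideal.quotient_is_cring[OF sym_ideal_ideal mp_ring_cring])

lemma sym_ideal_constant_coeff:
  assumes "p \<in> sym_ideal s W"
  shows "Poly_Mapping.lookup p 0 = 0"
proof -
  interpret R: cring "mp_ring W :: ('w, 'k) mpoly ring" by (rule mp_ring_cring)
  let ?Z = "{p \<in> carrier (mp_ring W). 0 \<notin> Poly_Mapping.keys p} :: ('w, 'k) mpoly set"
  have mult: "0 \<notin> Poly_Mapping.keys (x * p)" if p: "0 \<notin> Poly_Mapping.keys p"
    for x p :: "('w, 'k) mpoly"
  proof
    assume "0 \<in> Poly_Mapping.keys (x * p)"
    then obtain a b where ab: "0 = a + b" "b \<in> Poly_Mapping.keys p"
      using Poly_Mapping.keys_mult[of x p] by blast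
    have "Poly_Mapping.lookup b i = 0" for i
      using arg_cong[OF ab(1), of "\<lambda>m. Poly_Mapping.lookup m i"] by (simp add: lookup_add)
    then have "b = 0" by (simp add: poly_mapping_eqI)
    with ab p show False by simp
  qed
  have "ideal ?Z (mp_ring W)"
  proof (rule idealI)
    show "subgroup ?Z (add_monoid (mp_ring W))"
    proof (rule R.add.subgroupI)
      fix a :: "('w, 'k) mpoly" assume "a \<in> ?Z"
      then show "\<ominus>\<^bsub>mp_ring W\<^esub> a \<in> ?Z"
        by (auto simp: mp_ring_minus mp_ring_simps)
    next
      fix a b :: "('w, 'k) mpoly" assume ab: "a \<in> ?Z" "b \<in> ?Z"
      then have "a \<oplus>\<^bsub>mp_ring W\<^esub> b \<in> carrier (mp_ring W)" by blast
      then show "a \<oplus>\<^bsub>mp_ring W\<^esub> b \<in> ?Z"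
        using ab Poly_Mapping.keys_add[of a b] by (auto simp: mp_ring_simps(4))
    qed (auto simp: mp_ring_simps intro!: exI[of _ 0])
  next
    fix a x :: "('w, 'k) mpoly" assume ax: "a \<in> ?Z" "x \<in> carrier (mp_ring W)"
    then have "x \<otimes>\<^bsub>mp_ring W\<^esub> a \<in> carrier (mp_ring W)" by blast
    then show xa: "x \<otimes>\<^bsub>mp_ring W\<^esub> a \<in> ?Z"
      using mult[of a x] ax by (simp add: mp_ring_simps(2))
    then show "a \<otimes>\<^bsub>mp_ring W\<^esub> x \<in> ?Z" by (simp add: mp_ring_simps(2) mult.commute)
  qed (rule R.ring_axioms)
  moreover have "sym_relations s W \<subseteq> ?Z"
  proof -
    have v: "Poly_Mapping.lookup (mp_var w :: ('w, 'k) mpoly) 0 = 0" for w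
    proof -
      have "Poly_Mapping.single w (1::nat) \<noteq> 0" using lookup_single_eq[of w "1::nat"] by (metis lookup_zero one_neq_zero)
      then show ?thesis by (simp add: mp_var_def lookup_single)
    qed
    then have vk: "0 \<notin> Poly_Mapping.keys (mp_var w :: ('w, 'k) mpoly)" for w
      by (simp add: in_keys_iff)
    have "Poly_Mapping.lookup p 0 = 0" if "p \<in> sym_relations s W" for p
      using that v mult[OF vk] unfolding sym_relations_def
      by (auto simp: lookup_minus in_keys_iff)
    then show ?thesis using sym_relations_closed by (auto simp: in_keys_iff)
  qed
  ultimately have "sym_ideal s W \<subseteq> ?Z"
    unfolding sym_ideal_def by (rule R.genideal_minimal)
  then show ?thesis using assms by (auto simp: in_keys_iff)
qed

lemma sym_scalars_subfield: "subfield (sym_scalars s W) (Sym s W)"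
proof -
  interpret R: cring "mp_ring W :: ('w, 'k) mpoly ring" by (rule mp_ring_cring)
  interpret S: cring "Sym s W" by (rule Sym_cring)
  interpret I: ideal "sym_ideal s W" "mp_ring W :: ('w, 'k) mpoly ring" by (rule sym_ideal_ideal)
  interpret h: ring_hom_ring "mp_ring W" "Sym s W" "(+>\<^bsub>mp_ring W\<^esub>) (sym_ideal s W)"
    unfolding Sym_def by (rule I.rcos_ring_hom_ring)
  let ?C = "range mp_const :: ('w, 'k) mpoly set"
  have add: "mp_const a + mp_const b = mp_const (a + b)"
    and mul: "mp_const a * mp_const b = mp_const (a * b)"
    and neg: "- mp_const a = mp_const (- a)"
    and one: "1 = mp_const 1" and zero: "0 = mp_const 0"
    for a b :: 'k
    by (simp_all add: mp_const_def single_add mult_single single_uminus)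
  have inj: "mp_const a = mp_const b \<longleftrightarrow> a = b" for a b :: 'k
    by (metis lookup_single_eq mp_const_def)
  have sub: "subcring ?C (mp_ring W)"
  proof (rule R.subcringI', rule R.subringI)
    show "?C \<subseteq> carrier (mp_ring W)" using mp_const_closed by blast
    show "\<one>\<^bsub>mp_ring W\<^esub> \<in> ?C" by (simp add: mp_ring_simps one)
  next
    fix x :: "('w, 'k) mpoly" assume "x \<in> ?C"
    then show "\<ominus>\<^bsub>mp_ring W\<^esub> x \<in> ?C"
      by (auto simp: mp_ring_minus[OF mp_const_closed] neg)
  qed (auto simp: mp_ring_simps add mul)
  have "subfield ?C (mp_ring W)"
  proof (rule R.subfieldI[OF sub])
    show "Units (mp_ring W\<lparr>carrier := ?C\<rparr>) = ?C - {\<zero>\<^bsub>mp_ring W\<^esub>}"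
    proof (intro equalityI subsetI)
      fix x assume "x \<in> Units (mp_ring W\<lparr>carrier := ?C\<rparr>)"
      then show "x \<in> ?C - {\<zero>\<^bsub>mp_ring W\<^esub>}"
        by (auto simp: Units_def mp_ring_simps)
    next
      fix x assume x: "x \<in> ?C - {\<zero>\<^bsub>mp_ring W\<^esub>}"
      then obtain c where c: "x = mp_const c" "c \<noteq> 0"
        by (auto simp: mp_ring_simps zero inj)
      then have "mp_const (inverse c) * x = 1" "x * mp_const (inverse c) = 1"
        by (simp_all add: mul one)
      then show "x \<in> Units (mp_ring W\<lparr>carrier := ?C\<rparr>)"
        using x by (auto simp: Units_def mp_ring_simps)
    qed
  qed
  moreover have "\<one>\<^bsub>Sym s W\<^esub> \<noteq> \<zero>\<^bsub>Sym s W\<^esub>"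
  proof
    assume eq: "\<one>\<^bsub>Sym s W\<^esub> = \<zero>\<^bsub>Sym s W\<^esub>"
    have "\<one>\<^bsub>Sym s W\<^esub> = sym_ideal s W +>\<^bsub>mp_ring W\<^esub> \<one>\<^bsub>mp_ring W\<^esub>"
      and "\<zero>\<^bsub>Sym s W\<^esub> = sym_ideal s W"
      unfolding Sym_def FactRing_def by simp_all
    with eq I.a_rcos_self[OF R.one_closed] have "\<one>\<^bsub>mp_ring W\<^esub> \<in> sym_ideal s W"
      by metis
    then have "Poly_Mapping.lookup (1 :: ('w, 'k) mpoly) 0 = 0"
      unfolding mp_ring_simps(3) by (rule sym_ideal_constant_coeff)
    then show False by simp
  qed
  ultimately have "subfield ((+>\<^bsub>mp_ring W\<^esub>) (sym_ideal s W) ` ?C) (Sym s W)"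
    by (rule h.img_is_subfield(2))
  then show ?thesis by (simp add: sym_scalars_def image_image)
qed

end


section \<open>The spaces spanned by products of linear forms\<close>

text \<open>The span of a set over a subfield; the library only has the span of a finite list.\<close>

definition linear_span :: "('a, 'b) ring_scheme \<Rightarrow> 'a set \<Rightarrow> 'a set \<Rightarrow> 'a set" where
  "linear_span R K F = (\<Union>us\<in>lists F. ring.Span R K us)"

definition form_prod ::
    "('k::field \<Rightarrow> 'v::ab_group_add \<Rightarrow> 'v) \<Rightarrow> (nat \<Rightarrow> 'v \<Rightarrow> 'k) \<Rightarrow> nat set
      \<Rightarrow> ('v \<Rightarrow> 'k, 'k) mpoly set" where
  "form_prod scale \<alpha> S =
     (\<Otimes>\<^bsub>Sym fun_scale (dual_space scale)\<^esub>i\<in>S. sym_inc fun_scale (dual_space scale) (\<alpha> i))"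

definition P_space ::
    "('k::field \<Rightarrow> 'v::ab_group_add \<Rightarrow> 'v) \<Rightarrow> nat \<Rightarrow> (nat \<Rightarrow> 'v \<Rightarrow> 'k) \<Rightarrow> nat \<Rightarrow> nat
      \<Rightarrow> ('v \<Rightarrow> 'k, 'k) mpoly set set" where
  "P_space scale n \<alpha> j k =
     linear_span (Sym fun_scale (dual_space scale)) (sym_scalars fun_scale (dual_space scale))
       {form_prod scale \<alpha> S | S.
          S \<subseteq> {1..n} \<and> form_rank \<alpha> ({1..n} - S) = j \<and> card ({1..n} - S) = k}"

definition P_dim ::
    "('k::field \<Rightarrow> 'v::ab_group_add \<Rightarrow> 'v) \<Rightarrow> nat \<Rightarrow> (nat \<Rightarrow> 'v \<Rightarrow> 'k) \<Rightarrow> nat \<Rightarrow> nat \<Rightarrow> nat" where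
  "P_dim scale n \<alpha> j k =
     ring.dim (Sym fun_scale (dual_space scale)) (sym_scalars fun_scale (dual_space scale))
       (P_space scale n \<alpha> j k)"

lemma dual_space_subspace:
  fixes scale :: "'a::field \<Rightarrow> 'v::ab_group_add \<Rightarrow> 'v"
  assumes "vector_space scale"
  shows "fun_vs.subspace (dual_space scale)"
proof -
  interpret V: vector_space scale by (rule assms)
  interpret K: vector_space "(*) :: 'a \<Rightarrow> 'a \<Rightarrow> 'a"
    by unfold_locales (auto simp: algebra_simps)
  have iff: "Vector_Spaces.linear scale (*) f \<longleftrightarrow>
      (\<forall>x y. f (x + y) = f x + f y) \<and> (\<forall>c x. f (scale c x) = c * f x)" for f
    by (simp add: Vector_Spaces.linear_def module_hom_iff V.vector_space_axioms
        V.module_axioms K.vector_space_axioms K.module_axioms)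
  show ?thesis
    unfolding fun_vs.subspace_def dual_space_def mem_Collect_eq iff
    by (simp add: fun_scale_def distrib_left mult.left_commute add.assoc add.left_commute)
qed

end

theory Submission
  imports Defs
begin

text \<open>Call \<open>T \<subseteq> E\<close> saturated if no form \<open>\<alpha>\<^sub>e\<close> with \<open>e \<notin> T\<close> lies in the span of the forms \<open>\<alpha>\<^sub>b\<close> with
  \<open>b \<in> T\<close>, \<open>b > e\<close>; the saturated sets are the sets \<open>B \<union> EA(B)\<close>, where \<open>EA(B)\<close> consists of the
  externally active elements of an independent set \<open>B\<close>.  The products \<open>\<alpha>\<^bsub>E-T\<^esub>\<close> with \<open>T\<close> saturated, of
  rank \<open>j\<close> and size \<open>k\<close>, form a basis of \<open>P(\<Delta>)\<^bsub>j,k\<^esub>\<close>.  They span: if \<open>\<alpha>\<^sub>e\<close> violates saturation, expand it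
  in a minimal set of forms \<open>\<alpha>\<^sub>b\<close>, which rewrites \<open>\<alpha>\<^bsub>E-T\<^esub>\<close> in terms of sets \<open>T - b + e\<close> of the same rank
  and size but smaller sum of elements.  They are independent, by induction on \<open>n\<close>: modulo \<open>\<alpha>\<^sub>n\<close> a
  relation only involves the sets containing \<open>n\<close>, and what remains can be divided by \<open>\<alpha>\<^sub>n\<close>.
  Deletion and contraction of \<open>n\<close> also show that the sum of \<open>(x - 1)\<^bsup>\<ell>-r(T)\<^esup> y\<^bsup>|T|-r(T)\<^esup>\<close> over the
  saturated sets is the Tutte polynomial.\<close>

section \<open>Saturated sets and the Tutte polynomial\<close>

text \<open>The set \<open>F\<close> collects contracted vectors; \<open>cl\<close> is the closure operator \<open>span\<close>.\<close>

definition saturated :: "('b set \<Rightarrow> 'b set) \<Rightarrow> 'b set \<Rightarrow> (nat \<Rightarrow> 'b) \<Rightarrow> nat \<Rightarrow> nat set set" where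
  "saturated cl F \<alpha> n =
     {T. T \<subseteq> {1..n} \<and> (\<forall>e\<in>{1..n} - T. \<alpha> e \<notin> cl (F \<union> \<alpha> ` {b\<in>T. e < b}))}"

lemma finite_saturated: "finite (saturated cl F \<alpha> n)"
  by (rule finite_subset[of _ "Pow {1..n}"]) (auto simp: saturated_def)

lemma saturated_0: "saturated cl F \<alpha> 0 = {{}}"
  by (auto simp: saturated_def)

section \<open>Splitting sums by the largest element\<close>

lemma sum_Pow_Suc:
  "(\<Sum>A\<in>Pow {1..Suc n}. g A) =
     (\<Sum>A\<in>Pow {1..n}. g A) + (\<Sum>A\<in>Pow {1..n}. g (insert (Suc n) A))"
  for g :: "nat set \<Rightarrow> 'r::comm_monoid_add"
proof -
  have "(\<Sum>A\<in>insert (Suc n) ` Pow {1..n}. g A) = (\<Sum>A\<in>Pow {1..n}. g (insert (Suc n) A))"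
    by (rule sum.reindex_cong[OF _ refl refl], rule inj_onI)
      (metis PowD Suc_n_not_le_n atLeastAtMost_iff insert_ident subsetD)
  moreover have "(\<Sum>A\<in>Pow {1..Suc n}. g A) =
      (\<Sum>A\<in>Pow {1..n}. g A) + (\<Sum>A\<in>insert (Suc n) ` Pow {1..n}. g A)"
  proof -
    have "{1..Suc n} = insert (Suc n) {1..n}" by auto
    then show ?thesis
      by (simp only: Pow_insert) (rule sum.union_disjoint; auto)
  qed
  ultimately show ?thesis by simp
qed

text \<open>Deletion and contraction of the largest element. If \<open>Suc n\<close> is outside
  \<open>T\<close>, nothing in \<open>T\<close> exceeds it, so its own condition is about
  \<open>cl F\<close> and the other conditions are unchanged. If it is in \<open>T\<close>, it
  exceeds every \<open>e \<le> n\<close>, so its vector joins the contracted set in every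
  condition.\<close>

lemma saturated_Suc:
  "saturated cl F \<alpha> (Suc n) =
     (if \<alpha> (Suc n) \<in> cl F then {} else saturated cl F \<alpha> n) \<union>
     insert (Suc n) ` saturated cl (insert (\<alpha> (Suc n)) F) \<alpha> n" (is "?L = ?A \<union> ?B")
proof -
  have in_A: "T \<in> ?L \<longleftrightarrow> T \<in> ?A" if "Suc n \<notin> T" for T
  proof (cases "T \<subseteq> {1..n}")
    case True
    then have none: "{b \<in> T. Suc n < b} = {}" by auto
    have "{1..Suc n} - T = insert (Suc n) ({1..n} - T)"
      using that by auto
    then have "T \<in> ?L \<longleftrightarrow> \<alpha> (Suc n) \<notin> cl F \<and> T \<in> saturated cl F \<alpha> n"
      using True none by (auto simp: saturated_def simp del: Collect_empty_eq)
    then show ?thesis by simp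
  next
    case False
    then have "\<not> T \<subseteq> {1..Suc n}" using that by (auto simp: le_Suc_eq)
    with False show ?thesis by (auto simp: saturated_def)
  qed
  have ins: "insert (Suc n) T \<in> ?L \<longleftrightarrow> T \<in> saturated cl (insert (\<alpha> (Suc n)) F) \<alpha> n"
    if "Suc n \<notin> T" for T
  proof (cases "T \<subseteq> {1..n}")
    case True
    have "{b \<in> insert (Suc n) T. e < b} = insert (Suc n) {b \<in> T. e < b}" if "e \<in> {1..n}" for e
      using that by auto
    moreover have "{1..Suc n} - insert (Suc n) T = {1..n} - T"
      using True by auto
    ultimately show ?thesis
      using True by (auto simp: saturated_def)
  next
    case False
    then have "\<not> T \<subseteq> {1..Suc n}" using that by (auto simp: le_Suc_eq)
    with False show ?thesis by (auto simp: saturated_def)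
  qed
  have nA: "Suc n \<notin> T" if "T \<in> saturated cl F' \<alpha> n" for F' T
    using that by (auto simp: saturated_def)
  show ?thesis
  proof (rule Set.set_eqI)
    fix T show "T \<in> ?L \<longleftrightarrow> T \<in> ?A \<union> ?B"
    proof (cases "Suc n \<in> T")
      case True
      then obtain T' where T': "T = insert (Suc n) T'" "Suc n \<notin> T'"
        by (meson Set.set_insert)
      have "T \<in> ?B \<longleftrightarrow> T' \<in> saturated cl (insert (\<alpha> (Suc n)) F) \<alpha> n"
        unfolding T'(1) using nA T'(2) by (auto simp: insert_ident)
      with T' ins True nA show ?thesis by auto
    qed (use in_A in auto)
  qed
qed

lemma sum_saturated_Suc:
  "(\<Sum>T\<in>saturated cl F \<alpha> (Suc n). g T) =
     (if \<alpha> (Suc n) \<in> cl F then 0 else \<Sum>T\<in>saturated cl F \<alpha> n. g T) +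
     (\<Sum>T\<in>saturated cl (insert (\<alpha> (Suc n)) F) \<alpha> n. g (insert (Suc n) T))"
    (is "_ = ?a + (\<Sum>T\<in>?S. _)")
proof -
  have nA: "Suc n \<notin> T" if "T \<in> saturated cl F' \<alpha> n" for F' T
    using that by (auto simp: saturated_def)
  have "(\<Sum>T\<in>insert (Suc n) ` ?S. g T) = (\<Sum>T\<in>?S. g (insert (Suc n) T))"
    by (rule sum.reindex_cong[OF _ refl refl]) (metis nA inj_onI insert_ident)
  moreover have "(\<Sum>T\<in>saturated cl F \<alpha> (Suc n). g T) =
      ?a + (\<Sum>T\<in>insert (Suc n) ` ?S. g T)"
    unfolding saturated_Suc
    by (subst sum.union_disjoint) (use nA in \<open>auto simp: finite_saturated\<close>)
  ultimately show ?thesis by simp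
qed

section \<open>Rank counts and the deletion-contraction recursion\<close>

context vector_space
begin

lemma dim_insert_finite:
  assumes "finite F"
  shows "dim (insert a F) = (if a \<in> span F then dim F else Suc (dim F))"
proof (cases "a \<in> span F")
  case True
  then show ?thesis
    using span_eq_dim[OF span_redundant] by simp
next
  case False
  obtain I where I: "I \<subseteq> F" "independent I" "F \<subseteq> span I"
    using maximal_independent_subset by blast
  have "a \<notin> span I"
    using False I(1) span_mono by blast
  then have "independent (insert a I)"
    using I(2) by (rule independent_insertI)
  moreover have "insert a F \<subseteq> span (insert a I)"
    using I(3) span_mono[of I "insert a I"] span_base[of a "insert a I"] by auto
  ultimately have "card (insert a I) = dim (insert a F)"
    using I(1) by (intro basis_card_eq_dim) auto
  moreover have "card I = dim F"
    using I by (intro basis_card_eq_dim)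
  moreover have "finite I" "a \<notin> I"
    using I(1) assms finite_subset False span_base by auto
  ultimately show ?thesis
    using False by simp
qed

lemma dim_Un_le:
  assumes "finite F" "finite A"
  shows "dim (F \<union> f ` A) \<le> dim F + card A"
  using assms(2)
proof induction
  case (insert a A)
  then show ?case
    using assms(1) by (simp add: dim_insert_finite)
qed simp

text \<open>Both sides obey the same recursion in \<open>n\<close>: deletion keeps \<open>F\<close>,
  contraction enlarges it. The exponent is the nullity after contracting \<open>F\<close>. The
  weight \<open>w\<close> depends on the total dimension including \<open>F\<close>, so one
  \<open>w\<close> serves both minors; for \<open>F = {}\<close> and
  \<open>w r = (x - 1) ^ (l - r)\<close> the left side becomes the Tutte polynomial.\<close>

lemma sum_Pow_eq_sum_saturated:
  fixes w :: "nat \<Rightarrow> 'r::comm_ring_1" and y :: 'r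
  assumes "finite F"
  shows "(\<Sum>A\<in>Pow {1..n}. w (dim (F \<union> \<alpha> ` A)) * (y - 1) ^ (card A + dim F - dim (F \<union> \<alpha> ` A))) =
    (\<Sum>T\<in>saturated span F \<alpha> n. w (dim (F \<union> \<alpha> ` T)) * y ^ (card T + dim F - dim (F \<union> \<alpha> ` T)))"
    (is "?L n F = ?R n F")
  using assms
proof (induction n arbitrary: F)
  case 0
  then show ?case by (simp add: saturated_0)
next
  case (Suc n)
  let ?a = "\<alpha> (Suc n)"
  let ?F = "insert ?a F"
  have card: "card (insert (Suc n) A) = Suc (card A)" if "A \<subseteq> {1..n}" for A
  proof -
    have "finite A" "Suc n \<notin> A" using that finite_subset by auto
    then show ?thesis by simp
  qed
  have sub: "T \<subseteq> {1..n}" if "T \<in> saturated span F' \<alpha> n" for F' T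
    using that by (auto simp: saturated_def)
  have IH: "?L n F = ?R n F" "?L n ?F = ?R n ?F"
    using Suc by blast+
  show ?case
  proof (cases "?a \<in> span F")
    \<comment> \<open>A loop: on the left, \<open>A\<close> and \<open>insert (Suc n) A\<close> have
      the same rank and contribute the factors \<open>1\<close> and \<open>y - 1\<close>, in total
      \<open>y\<close>. On the right every saturated set contains the loop, which contributes one
      factor \<open>y\<close>.\<close>
    case True
    have sp: "span (?F \<union> X) = span (F \<union> X)" for X
      using True span_mono[of F "F \<union> X"] by (auto intro!: span_redundant)
    have dims: "dim ?F = dim F" "dim (F \<union> \<alpha> ` insert (Suc n) A) = dim (F \<union> \<alpha> ` A)"
      "dim (?F \<union> \<alpha> ` A) = dim (F \<union> \<alpha> ` A)" for A
      using span_eq_dim[OF sp[of "{}"]] span_eq_dim[OF sp[of "\<alpha> ` A"]] by auto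
    have exp: "card (insert (Suc n) A) + dim F - dim (F \<union> \<alpha> ` A) =
        Suc (card A + dim F - dim (F \<union> \<alpha> ` A))" if "A \<subseteq> {1..n}" for A
      using dim_Un_le[OF Suc.prems, of A \<alpha>] card[OF that] that finite_subset
      by (force simp: Suc_diff_le)
    have "?L (Suc n) F = ?L n F + ?L n F * (y - 1)"
      unfolding sum_Pow_Suc dims sum_distrib_right
      by (intro arg_cong2[of _ _ _ _ "(+)"] refl sum.cong) (simp add: exp)
    also have "\<dots> = ?L n ?F * y"
      unfolding dims by (simp add: algebra_simps)
    also have "\<dots> = ?R n ?F * y"
      by (simp only: IH)
    also have "\<dots> = ?R (Suc n) F"
      unfolding sum_saturated_Suc dims sum_distrib_right using True
      by (auto intro!: sum.cong simp: exp[OF sub] mult_ac simp del: Un_insert_left)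
    finally show ?thesis .
  next
    case False
    \<comment> \<open>Not a loop: the extra element of \<open>insert (Suc n) A\<close> is balanced
      by the larger dimension of \<open>?F\<close>, so the nullities agree and both sums split
      without extra factors.\<close>
    have dims: "dim ?F = Suc (dim F)" "F \<union> \<alpha> ` insert (Suc n) A = ?F \<union> \<alpha> ` A" for A
      using False Suc.prems by (auto simp: dim_insert_finite)
    have "?L (Suc n) F = ?L n F + ?L n ?F"
      unfolding sum_Pow_Suc dims
      by (intro arg_cong2[of _ _ _ _ "(+)"] refl sum.cong) (simp add: card)
    also have "\<dots> = ?R n F + ?R n ?F"
      by (simp only: IH)
    also have "\<dots> = ?R (Suc n) F"
      unfolding sum_saturated_Suc dims using False
      by (auto intro!: sum.cong simp: card[OF sub])
    finally show ?thesis .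
  qed
qed

end


section \<open>Evaluation of polynomials and elimination of a variable\<close>

text \<open>The map given by the universal property of the polynomial ring, with \<open>h\<close>
  acting on coefficients. It serves both for substitution of polynomials and for maps out of the
  symmetric algebra.\<close>

definition mp_eval :: "('k::field \<Rightarrow> 'r::comm_ring_1) \<Rightarrow> ('w \<Rightarrow> 'r) \<Rightarrow> ('w, 'k) mpoly \<Rightarrow> 'r" where
  "mp_eval h \<phi> p =
     (\<Sum>m\<in>Poly_Mapping.keys p.
        h (Poly_Mapping.lookup p m) * (\<Prod>w\<in>Poly_Mapping.keys m. \<phi> w ^ Poly_Mapping.lookup m w))"

lemma poly_mapping_sum_single:
  fixes p :: "'a \<Rightarrow>\<^sub>0 'b::comm_monoid_add"
  shows "p = (\<Sum>m\<in>Poly_Mapping.keys p. Poly_Mapping.single m (Poly_Mapping.lookup p m))"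
  by (rule poly_mapping_eqI)
    (auto simp: lookup_sum lookup_single when_def in_keys_iff sum.delta' sum.delta)

context
  fixes h :: "'k::field \<Rightarrow> 'r::comm_ring_1" and \<phi> :: "'w \<Rightarrow> 'r"
  assumes h_0: "h 0 = 0" and h_1: "h 1 = 1"
    and h_add: "h (a + b) = h a + h b" and h_mult: "h (a * b) = h a * h b"
begin

private definition mon :: "('w \<Rightarrow>\<^sub>0 nat) \<Rightarrow> 'r" where
  "mon m = (\<Prod>w\<in>Poly_Mapping.keys m. \<phi> w ^ Poly_Mapping.lookup m w)"

private lemma mon_superset:
  assumes "finite S" "Poly_Mapping.keys m \<subseteq> S"
  shows "mon m = (\<Prod>w\<in>S. \<phi> w ^ Poly_Mapping.lookup m w)"
  unfolding mon_def using assms by (intro prod.mono_neutral_left) (auto simp: in_keys_iff)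

private lemma mon_add: "mon (a + b) = mon a * mon b"
proof -
  let ?S = "Poly_Mapping.keys a \<union> Poly_Mapping.keys b"
  have "mon (a + b) = (\<Prod>w\<in>?S. \<phi> w ^ Poly_Mapping.lookup (a + b) w)"
    by (rule mon_superset) (use Poly_Mapping.keys_add[of a b] in auto)
  also have "\<dots> = mon a * mon b"
    by (simp add: lookup_add power_add prod.distrib mon_superset[of ?S])
  finally show ?thesis .
qed

private lemma mp_eval_superset:
  assumes "finite S" "Poly_Mapping.keys p \<subseteq> S"
  shows "mp_eval h \<phi> p = (\<Sum>m\<in>S. h (Poly_Mapping.lookup p m) * mon m)"
  unfolding mp_eval_def mon_def[symmetric]
  using assms by (intro sum.mono_neutral_left) (auto simp: in_keys_iff h_0)

lemma mp_eval_add: "mp_eval h \<phi> (p + q) = mp_eval h \<phi> p + mp_eval h \<phi> q"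
proof -
  let ?S = "Poly_Mapping.keys p \<union> Poly_Mapping.keys q"
  have "mp_eval h \<phi> (p + q) = (\<Sum>m\<in>?S. h (Poly_Mapping.lookup (p + q) m) * mon m)"
    by (rule mp_eval_superset) (use Poly_Mapping.keys_add[of p q] in auto)
  also have "\<dots> = mp_eval h \<phi> p + mp_eval h \<phi> q"
    by (simp add: lookup_add h_add distrib_right sum.distrib mp_eval_superset[of ?S])
  finally show ?thesis .
qed

lemma mp_eval_0: "mp_eval h \<phi> 0 = 0"
  by (simp add: mp_eval_def)

lemma mp_eval_diff: "mp_eval h \<phi> (p - q) = mp_eval h \<phi> p - mp_eval h \<phi> q"
  using mp_eval_add[of "p - q" q] by simp

lemma mp_eval_sum: "mp_eval h \<phi> (\<Sum>i\<in>I. f i) = (\<Sum>i\<in>I. mp_eval h \<phi> (f i))"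
  by (induction I rule: infinite_finite_induct) (simp_all add: mp_eval_0 mp_eval_add)

private lemma mp_eval_single: "mp_eval h \<phi> (Poly_Mapping.single m c) = h c * mon m"
  by (subst mp_eval_superset[of "{m}"]) (auto simp: h_0)

lemma mp_eval_mult: "mp_eval h \<phi> (p * q) = mp_eval h \<phi> p * mp_eval h \<phi> q"
proof -
  let ?s = "\<lambda>p m. Poly_Mapping.single m (Poly_Mapping.lookup p m)"
  have "p * q = (\<Sum>a\<in>Poly_Mapping.keys p. ?s p a) * (\<Sum>b\<in>Poly_Mapping.keys q. ?s q b)"
    using poly_mapping_sum_single[of p] poly_mapping_sum_single[of q] by simp
  then have "mp_eval h \<phi> (p * q) =
      (\<Sum>a\<in>Poly_Mapping.keys p. \<Sum>b\<in>Poly_Mapping.keys q. mp_eval h \<phi> (?s p a) * mp_eval h \<phi> (?s q b))"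
    by (simp add: sum_product mp_eval_sum mult_single mp_eval_single h_mult mon_add ac_simps)
  also have "\<dots> = mp_eval h \<phi> (\<Sum>a\<in>Poly_Mapping.keys p. ?s p a) *
      mp_eval h \<phi> (\<Sum>b\<in>Poly_Mapping.keys q. ?s q b)"
    by (simp add: sum_product mp_eval_sum)
  finally show ?thesis
    using poly_mapping_sum_single[of p] poly_mapping_sum_single[of q] by simp
qed

lemma mp_eval_const: "mp_eval h \<phi> (mp_const c) = h c"
  by (simp add: mp_const_def mp_eval_single mon_def)

lemma mp_eval_var: "mp_eval h \<phi> (mp_var w) = \<phi> w"
  by (simp add: mp_var_def mp_eval_single mon_def h_1)

lemma mp_eval_prod: "mp_eval h \<phi> (\<Prod>i\<in>I. f i) = (\<Prod>i\<in>I. mp_eval h \<phi> (f i))"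
  using mp_eval_const[of 1]
  by (induction I rule: infinite_finite_induct) (simp_all add: mp_const_def h_1 mp_eval_mult)

end

section \<open>Linear forms in coordinates and their reduction\<close>

lemma mp_const_0: "mp_const 0 = 0"
  and mp_const_1: "mp_const 1 = 1"
  and mp_const_add: "mp_const (a + b) = mp_const a + mp_const b"
  and mp_const_mult: "mp_const (a * b) = mp_const a * mp_const b"
  by (simp_all add: mp_const_def single_add mult_single)

text \<open>The linear form with coefficient vector \<open>a\<close>. Independence is proved with
  variables indexed by \<open>nat\<close>, whose linear order gives access to the absence of zero
  divisors in the polynomial ring.\<close>

definition lin_poly :: "nat \<Rightarrow> (nat \<Rightarrow> 'k::field) \<Rightarrow> (nat, 'k) mpoly" where
  "lin_poly l a = (\<Sum>i<l. mp_const (a i) * mp_var i)"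

lemma lin_poly_add: "lin_poly l (\<lambda>i. a i + b i) = lin_poly l a + lin_poly l b"
  by (simp add: lin_poly_def mp_const_add distrib_right sum.distrib)

lemma lin_poly_scale: "lin_poly l (\<lambda>i. c * a i) = mp_const c * lin_poly l a"
  by (simp add: lin_poly_def mp_const_mult mult.assoc sum_distrib_left)

text \<open>The coefficient of the \<open>i\<close>-th variable is \<open>a i\<close>.\<close>

lemma lin_poly_eq_0_iff: "lin_poly l a = 0 \<longleftrightarrow> (\<forall>i<l. a i = 0)"
proof
  assume *: "lin_poly l a = 0"
  show "\<forall>i<l. a i = 0"
  proof (intro allI impI)
    fix i assume "i < l"
    have single_eq: "Poly_Mapping.single j (1::nat) = Poly_Mapping.single i 1 \<longleftrightarrow> j = i" for j
      by (metis keys_single one_neq_zero singleton_inject)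
    have "Poly_Mapping.lookup (lin_poly l a) (Poly_Mapping.single i 1) =
        (\<Sum>j<l. if j = i then a j else 0)"
      unfolding lin_poly_def lookup_sum
      by (intro sum.cong refl) (auto simp: mp_const_def mp_var_def mult_single lookup_single when_def single_eq
          simp del: One_nat_def)
    then show "a i = 0"
      using \<open>i < l\<close> * by simp
  qed
qed (simp add: lin_poly_def mp_const_0)

text \<open>The substitution that eliminates \<open>x\<^sub>m\<close> by means of the linear equation \<open>c = 0\<close>, that is,
  reduction modulo the linear form \<open>c\<close>.\<close>

definition lin_elim :: "nat \<Rightarrow> nat \<Rightarrow> (nat \<Rightarrow> 'k::field) \<Rightarrow> (nat, 'k) mpoly \<Rightarrow> (nat, 'k) mpoly" where
  "lin_elim l m c = mp_eval mp_const
     (\<lambda>i. mp_var i - (if i = m then mp_const (1 / c m) * lin_poly l c else 0))"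

lemma lin_elim_add: "lin_elim l m c (p + q) = lin_elim l m c p + lin_elim l m c q"
  and lin_elim_mult: "lin_elim l m c (p * q) = lin_elim l m c p * lin_elim l m c q"
  and lin_elim_const: "lin_elim l m c (mp_const k) = mp_const k"
  and lin_elim_sum: "lin_elim l m c (\<Sum>i\<in>I. f i) = (\<Sum>i\<in>I. lin_elim l m c (f i))"
  and lin_elim_prod: "lin_elim l m c (\<Prod>j\<in>J. g j) = (\<Prod>j\<in>J. lin_elim l m c (g j))"
  unfolding lin_elim_def
  by (rule mp_eval_add mp_eval_mult mp_eval_const mp_eval_sum mp_eval_prod;
      rule mp_const_0 mp_const_1 mp_const_add mp_const_mult)+

text \<open>On coefficient vectors the substitution is one step of Gaussian elimination with pivot
  \<open>c m\<close>. If the pivot is nonzero, the form \<open>c\<close> itself is sent to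
  \<open>0\<close>.\<close>

lemma lin_elim_lin_poly:
  assumes "m < l"
  shows "lin_elim l m c (lin_poly l a) = lin_poly l (\<lambda>i. a i - a m / c m * c i)"
proof -
  let ?\<phi> = "\<lambda>i. mp_var i - (if i = m then mp_const (1 / c m) * lin_poly l c else 0)"
  have "lin_elim l m c (mp_var i) = ?\<phi> i" for i
    unfolding lin_elim_def
    by (rule mp_eval_var; rule mp_const_0 mp_const_1 mp_const_add mp_const_mult)
  then have "lin_elim l m c (lin_poly l a) = (\<Sum>i<l. mp_const (a i) * ?\<phi> i)"
    unfolding lin_poly_def[of l a] by (simp only: lin_elim_sum lin_elim_mult lin_elim_const)
  also have "\<dots> = lin_poly l a -
      (\<Sum>i<l. if i = m then mp_const (a m) * (mp_const (1 / c m) * lin_poly l c) else 0)"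
    unfolding lin_poly_def[of l a] sum_subtractf[symmetric]
    by (intro sum.cong refl) (simp add: right_diff_distrib)
  also have "\<dots> = lin_poly l a - mp_const (a m / c m) * lin_poly l c"
    using assms by (simp add: mp_const_mult[symmetric] mult.assoc[symmetric])
  also have "\<dots> = lin_poly l a - lin_poly l (\<lambda>i. a m / c m * c i)"
    by (simp only: lin_poly_scale)
  also have "\<dots> = lin_poly l (\<lambda>i. a i - a m / c m * c i)"
    using lin_poly_add[of l "\<lambda>i. a i - a m / c m * c i" "\<lambda>i. a m / c m * c i"] by simp
  finally show ?thesis .
qed

section \<open>Linear independence of the saturated products\<close>

context vector_space
begin

text \<open>The map \<psi> gives coordinates on \<open>W\<close> modulo \<open>span F\<close>, so
  \<open>lin_poly l (\<psi> v)\<close> represents the class of \<open>v\<close> in the symmetric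
  algebra of that quotient. Keeping \<open>F\<close> and \<psi> general lets the induction pass to
  the contraction, where both change.\<close>

lemma saturated_products_independent:
  fixes \<psi> :: "'b \<Rightarrow> nat \<Rightarrow> 'a"
  assumes W: "subspace W" "F \<subseteq> W" "\<And>i. i \<in> {1..n} \<Longrightarrow> \<alpha> i \<in> W"
    and \<psi>: "\<And>u v i. \<psi> (u + v) i = \<psi> u i + \<psi> v i" "\<And>k v i. \<psi> (scale k v) i = k * \<psi> v i"
    and ker: "\<And>v. v \<in> W \<Longrightarrow> (\<forall>i<l. \<psi> v i = 0) \<longleftrightarrow> v \<in> span F"
    and sum0: "(\<Sum>T\<in>saturated span F \<alpha> n.
      mp_const (c T) * (\<Prod>i\<in>{1..n} - T. lin_poly l (\<psi> (\<alpha> i)))) = 0"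
    and T: "T \<in> saturated span F \<alpha> n"
  shows "c T = 0"
  using assms
proof (induction n arbitrary: F \<psi> c T)
  case 0
  then have "mp_const (c {}) = (0 :: (nat, 'a) mpoly)" "T = {}"
    by (simp_all add: saturated_0)
  then show ?case
    by (metis lookup_single_eq lookup_zero mp_const_def)
next
  case (Suc n)
  let ?a = "\<alpha> (Suc n)"
  let ?F = "insert ?a F"
  let ?S = "saturated span F \<alpha> n" and ?S' = "saturated span ?F \<alpha> n"
  let ?p = "\<lambda>\<psi> T. \<Prod>i\<in>{1..n} - T. lin_poly l (\<psi> (\<alpha> i))"
  let ?c = "\<lambda>T. c (insert (Suc n) T)"
  have sub: "T \<subseteq> {1..n}" if "T \<in> saturated span F' \<alpha> n" for F' T
    using that by (auto simp: saturated_def)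
  have aW: "?a \<in> W" using Suc.prems(3) by simp
  have \<alpha>W: "\<And>i. i \<in> {1..n} \<Longrightarrow> \<alpha> i \<in> W" using Suc.prems(3) by simp
  have FW: "?F \<subseteq> W" using aW Suc.prems(2) by simp
  have del: "{1..Suc n} - T = insert (Suc n) ({1..n} - T)"
      "{1..Suc n} - insert (Suc n) T = {1..n} - T" if "T \<subseteq> {1..n}" for T
    using that by auto
  \<comment> \<open>\<open>A\<close> collects the sets without \<open>Suc n\<close>, after removal
    of the common factor belonging to \<open>?a\<close>; \<open>B\<close> collects the sets
    containing \<open>Suc n\<close>. The relation becomes \<open>?a\<close> times \<open>A\<close>
    plus \<open>B\<close>.\<close>
  define A where "A = (\<Sum>T\<in>?S. mp_const (c T) * ?p \<psi> T)"
  define B where "B = (\<Sum>T\<in>?S'. mp_const (?c T) * ?p \<psi> T)"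
  have "(\<Sum>T\<in>?S. mp_const (c T) * (\<Prod>i\<in>{1..Suc n} - T. lin_poly l (\<psi> (\<alpha> i)))) =
      lin_poly l (\<psi> ?a) * A"
    unfolding A_def sum_distrib_left
    by (intro sum.cong refl) (simp add: del(1)[OF sub] ac_simps del: One_nat_def)
  moreover have "(\<Sum>T\<in>?S'. mp_const (?c T) *
      (\<Prod>i\<in>{1..Suc n} - insert (Suc n) T. lin_poly l (\<psi> (\<alpha> i)))) = B"
    unfolding B_def by (intro sum.cong refl) (simp only: del(2)[OF sub])
  ultimately have eq: "(if ?a \<in> span F then 0 else lin_poly l (\<psi> ?a) * A) + B = 0"
    using Suc.prems(7) unfolding sum_saturated_Suc by (simp split: if_splits)
  show ?case
  proof (cases "?a \<in> span F")
    case True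
    \<comment> \<open>For a loop only \<open>B\<close> is present, and the same coordinates serve
      for the contraction.\<close>
    then have "span ?F = span F"
      by (rule span_redundant)
    moreover have "B = 0" using eq True by simp
    ultimately have "?c T = 0" if "T \<in> ?S'" for T
      using Suc.IH[where F = ?F and \<psi> = \<psi> and c = ?c and T = T, OF Suc.prems(1) FW \<alpha>W Suc.prems(4,5)] Suc.prems(6) that
      unfolding B_def by simp
    then show ?thesis
      using Suc.prems(8) True by (auto simp: saturated_Suc)
  next
    case False
    \<comment> \<open>Since \<open>?a\<close> lies outside the kernel, it has a nonzero coordinate,
      which is the pivot.\<close>
    then obtain m where m: "m < l" "\<psi> ?a m \<noteq> 0"
      using Suc.prems(6)[OF aW] by blast
    let ?\<sigma> = "lin_elim l m (\<psi> ?a)"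
    \<comment> \<open>The coordinates after reduction modulo the form of \<open>?a\<close>.\<close>
    define \<psi>' where "\<psi>' = (\<lambda>v i. \<psi> v i - \<psi> v m / \<psi> ?a m * \<psi> ?a i)"
    have "?\<sigma> (lin_poly l (\<psi> ?a)) = 0"
      using m(2) by (simp add: lin_elim_lin_poly[OF m(1)] lin_poly_eq_0_iff)
    moreover have "?\<sigma> 0 = 0"
      using lin_elim_const[of l m "\<psi> ?a" 0] by (simp add: mp_const_0)
    ultimately have "?\<sigma> B = 0"
      using arg_cong[OF eq, of ?\<sigma>] False by (simp add: lin_elim_add lin_elim_mult)
    \<comment> \<open>Reduction kills the part with \<open>A\<close> and leaves a relation among the
      products of the contraction.\<close>
    then have B': "(\<Sum>T\<in>?S'. mp_const (?c T) * ?p \<psi>' T) = 0"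
      by (simp add: B_def lin_elim_sum lin_elim_mult lin_elim_const lin_elim_prod lin_elim_lin_poly[OF m(1)] \<psi>'_def)
    have \<psi>diff: "\<psi> (v - scale k ?a) i = \<psi> v i - k * \<psi> ?a i" for v k i
      using Suc.prems(4)[of "v - scale k ?a" "scale k ?a" i] by (simp add: Suc.prems(5))
    \<comment> \<open>The reduced coordinates vanish exactly when \<open>\<psi> v\<close> is a
      multiple of \<open>\<psi> ?a\<close>, that is, when \<open>v\<close> minus that multiple of
      \<open>?a\<close> lies in \<open>span F\<close>.\<close>
    have ker': "(\<forall>i<l. \<psi>' v i = 0) \<longleftrightarrow> v \<in> span ?F" if v: "v \<in> W" for v
    proof -
      have mem: "v - scale k ?a \<in> span F \<longleftrightarrow> (\<forall>i<l. \<psi> v i = k * \<psi> ?a i)" for k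
        using Suc.prems(6)[of "v - scale k ?a"] v aW Suc.prems(1)
        by (simp add: \<psi>diff subspace_diff subspace_scale)
      show ?thesis
      proof
        assume "\<forall>i<l. \<psi>' v i = 0"
        then have "v - scale (\<psi> v m / \<psi> ?a m) ?a \<in> span F"
          by (simp add: mem \<psi>'_def)
        then show "v \<in> span ?F"
          unfolding span_insert by blast
      next
        assume "v \<in> span ?F"
        then obtain k where k: "\<And>i. i < l \<Longrightarrow> \<psi> v i = k * \<psi> ?a i"
          unfolding span_insert using mem by blast
        then show "\<forall>i<l. \<psi>' v i = 0"
          using k[OF m(1)] m(2) by (simp add: \<psi>'_def)
      qed
    qed
    have c': "?c T = 0" if "T \<in> ?S'" for T
    proof (rule Suc.IH[where F = ?F and \<psi> = \<psi>' and c = ?c, OF Suc.prems(1) FW \<alpha>W _ _ ker' B' that])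
      show "\<psi>' (u + v) i = \<psi>' u i + \<psi>' v i" "\<psi>' (scale k v) i = k * \<psi>' v i" for u v k i
        by (simp_all add: \<psi>'_def Suc.prems(4,5) algebra_simps add_divide_distrib)
    qed
    then have "B = 0"
      by (simp add: B_def mp_const_0)
    moreover have "lin_poly l (\<psi> ?a) \<noteq> 0"
      using m by (auto simp: lin_poly_eq_0_iff)
    \<comment> \<open>With \<open>B = 0\<close>, the nonzero form of \<open>?a\<close> cancels, and
      the relation \<open>A = 0\<close> belongs to the deletion.\<close>
    ultimately have "A = 0"
      using eq False by simp
    then have "c T = 0" if "T \<in> ?S" for T
      using Suc.IH[where F = F and \<psi> = \<psi> and c = c, OF Suc.prems(1,2) \<alpha>W Suc.prems(4,5,6) _ that] unfolding A_def by simp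
    then show ?thesis
      using Suc.prems(8) False c' by (auto simp: saturated_Suc)
  qed
qed

end


section \<open>Bases of spaces of products of linear forms\<close>

text \<open>Reduces the span of a set to that of a finite list, for which dimensions can be computed
  from independence.\<close>

lemma (in ring) linear_span_eq_Span:
  assumes K: "subfield K R" and Us: "set Us \<subseteq> F" and F: "F \<subseteq> Span K Us" "set Us \<subseteq> carrier R"
  shows "linear_span R K F = Span K Us"
proof
  have "Span K us \<subseteq> Span K Us" if "us \<in> lists F" for us
  proof (rule Span_min[OF K])
    show us: "set us \<subseteq> carrier R"
      using that F Span_subgroup_props(1)[OF K F(2)] by blast
    show "subgroup (Span K Us) (add_monoid R)"
      by (rule Span_is_add_subgroup[OF K F(2)])
    show "K <#> set us \<subseteq> Span K Us"
      using that F(1) Span_smult_closed[OF K F(2)]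
      by (auto simp: set_mult_def simp del: Span.simps)
  qed
  then show "linear_span R K F \<subseteq> Span K Us"
    unfolding linear_span_def by blast
  show "Span K Us \<subseteq> linear_span R K F"
    unfolding linear_span_def using Us by blast
qed

text \<open>Turns the coefficient list of a combination into a function of the indices; distinctness
  makes it well defined.\<close>

lemma ex_map_eq:
  assumes "distinct ts" "length Ks = length ts" "set Ks \<subseteq> range g"
  shows "\<exists>c. Ks = map (\<lambda>t. g (c t)) ts"
  using assms
proof (induction ts arbitrary: Ks)
  case (Cons t ts)
  then obtain k Ks' where Ks: "Ks = g k # Ks'" "length Ks' = length ts" "set Ks' \<subseteq> range g"
    by (cases Ks) auto
  then obtain c where c: "Ks' = map (\<lambda>t. g (c t)) ts"
    using Cons.IH[of Ks'] Cons.prems(1) by auto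
  have "map (\<lambda>t'. g ((c(t := k)) t')) ts = Ks'"
    using Cons.prems(1) c by auto
  then have "Ks = map (\<lambda>t'. g ((c(t := k)) t')) (t # ts)"
    using Ks(1) by simp
  then show ?case by blast
qed simp

section \<open>Calculation in the symmetric algebra through polynomial representatives\<close>

locale sym_algebra = vector_space scale
  for scale :: "'a::field \<Rightarrow> 'b::ab_group_add \<Rightarrow> 'b" +
  fixes W :: "'b set"
  assumes W: "subspace W"
begin

abbreviation (input) R :: "('b, 'a) mpoly ring" where "R \<equiv> mp_ring W"
abbreviation (input) S :: "('b, 'a) mpoly set ring" where "S \<equiv> Sym scale W"
abbreviation (input) scalars :: "('b, 'a) mpoly set set" where "scalars \<equiv> sym_scalars scale W"

definition proj :: "('b, 'a) mpoly \<Rightarrow> ('b, 'a) mpoly set" where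
  "proj p = sym_ideal scale W +>\<^bsub>R\<^esub> p"

sublocale R: cring R by (rule mp_ring_cring)
sublocale S: cring S by (rule Sym_cring[OF vector_space_axioms W])
sublocale I: ideal "sym_ideal scale W" R by (rule sym_ideal_ideal[OF vector_space_axioms W])
sublocale proj: ring_hom_ring R S proj
  unfolding Sym_def proj_def[abs_def] by (rule I.rcos_ring_hom_ring)

lemma scalars_subfield: "subfield scalars S"
  by (rule sym_scalars_subfield[OF vector_space_axioms W])

lemma scalars_eq: "scalars = range (\<lambda>c. proj (mp_const c))"
  by (simp add: sym_scalars_def proj_def)

lemma proj_eq_zero_iff:
  assumes "p \<in> carrier R"
  shows "proj p = \<zero>\<^bsub>S\<^esub> \<longleftrightarrow> p \<in> sym_ideal scale W"
  using I.a_rcos_self[OF assms] I.a_rcos_const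
  by (auto simp: proj_def Sym_def FactRing_def)

lemma carrier_mult: "p \<in> carrier R \<Longrightarrow> q \<in> carrier R \<Longrightarrow> p * q \<in> carrier R"
  using R.m_closed[of p q] by (simp add: mp_ring_simps(2))

lemma carrier_add: "p \<in> carrier R \<Longrightarrow> q \<in> carrier R \<Longrightarrow> p + q \<in> carrier R"
  using R.a_closed[of p q] by (simp add: mp_ring_simps(4))

lemma carrier_prod: "(\<And>i. i \<in> A \<Longrightarrow> p i \<in> carrier R) \<Longrightarrow> (\<Prod>i\<in>A. p i) \<in> carrier R"
  using R.one_closed
  by (induction A rule: infinite_finite_induct) (auto simp: mp_ring_simps(3) intro: carrier_mult)

lemma proj_mult: "p \<in> carrier R \<Longrightarrow> q \<in> carrier R \<Longrightarrow> proj (p * q) = proj p \<otimes>\<^bsub>S\<^esub> proj q"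
  using proj.hom_mult[of p q] by (simp add: mp_ring_simps(2))

lemma proj_add: "p \<in> carrier R \<Longrightarrow> q \<in> carrier R \<Longrightarrow> proj (p + q) = proj p \<oplus>\<^bsub>S\<^esub> proj q"
  using proj.hom_add[of p q] by (simp add: mp_ring_simps(4))

lemma proj_eqI:
  assumes "p \<in> carrier R" "q \<in> carrier R" "p - q \<in> sym_ideal scale W"
  shows "proj p = proj q"
proof -
  have "p - q \<in> carrier R"
    using assms(3) I.a_subset by blast
  then have "proj p = proj (p - q) \<oplus>\<^bsub>S\<^esub> proj q"
    using proj_add[of "p - q" q] assms by simp
  also have "\<dots> = proj q"
    using assms \<open>p - q \<in> carrier R\<close> by (simp add: proj_eq_zero_iff)
  finally show ?thesis .
qed

lemma relations_subset: "sym_relations scale W \<subseteq> sym_ideal scale W"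
  unfolding sym_ideal_def
  by (rule R.genideal_self[OF sym_relations_closed[OF vector_space_axioms W]])

lemma proj_var_add:
  assumes "u \<in> W" "w \<in> W"
  shows "proj (mp_var (u + w)) = proj (mp_var u) \<oplus>\<^bsub>S\<^esub> proj (mp_var w)"
proof -
  have "mp_var (u + w) - mp_var u - mp_var w \<in> sym_ideal scale W"
    using relations_subset assms unfolding sym_relations_def by blast
  then have "proj (mp_var (u + w)) = proj (mp_var u + mp_var w)"
    using assms W
    by (intro proj_eqI carrier_add mp_var_closed) (auto simp: diff_diff_add subspace_add)
  then show ?thesis
    using assms by (simp add: proj_add mp_var_closed)
qed

lemma proj_var_scale:
  assumes "w \<in> W"
  shows "proj (mp_var (scale c w)) = proj (mp_const c) \<otimes>\<^bsub>S\<^esub> proj (mp_var w)"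
proof -
  have "mp_var (scale c w) - mp_const c * mp_var w \<in> sym_ideal scale W"
    using relations_subset assms unfolding sym_relations_def by blast
  then have "proj (mp_var (scale c w)) = proj (mp_const c * mp_var w)"
    using assms W
    by (intro proj_eqI carrier_mult mp_var_closed mp_const_closed) (auto simp: subspace_scale)
  then show ?thesis
    using assms by (simp add: proj_mult mp_var_closed mp_const_closed)
qed

lemma finprod_sym_inc:
  assumes "\<And>i. i \<in> A \<Longrightarrow> \<alpha> i \<in> W" "finite A"
  shows "(\<Otimes>\<^bsub>S\<^esub>i\<in>A. sym_inc scale W (\<alpha> i)) = proj (\<Prod>i\<in>A. mp_var (\<alpha> i))"
  using assms(2,1)
proof (induction A)
  case empty
  then show ?case
    using proj.hom_one by (simp add: mp_ring_simps(3))
next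
  case (insert a A)
  have inc: "sym_inc scale W (\<alpha> i) = proj (mp_var (\<alpha> i))" for i
    by (simp add: sym_inc_def proj_def)
  have "(\<Prod>i\<in>A. mp_var (\<alpha> i)) \<in> carrier R"
    using insert.prems by (intro carrier_prod mp_var_closed) auto
  then show ?case
    using insert by (simp add: inc proj_mult mp_var_closed Pi_iff)
qed

text \<open>The universal property of the symmetric algebra: the zeros of an evaluation form an
  ideal, and linearity of \<phi> on \<open>W\<close> puts the defining relations in it.\<close>

lemma mp_eval_sym_ideal:
  fixes h :: "'a \<Rightarrow> 'r::comm_ring_1"
  assumes h: "h 0 = 0" "h 1 = 1" "\<And>a b. h (a + b) = h a + h b" "\<And>a b. h (a * b) = h a * h b"
    and \<phi>: "\<And>u w. u \<in> W \<Longrightarrow> w \<in> W \<Longrightarrow> \<phi> (u + w) = \<phi> u + \<phi> w"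
      "\<And>c w. w \<in> W \<Longrightarrow> \<phi> (scale c w) = h c * \<phi> w"
    and p: "p \<in> sym_ideal scale W"
  shows "mp_eval h \<phi> p = 0"
proof -
  let ?Z = "{p \<in> carrier R. mp_eval h \<phi> p = 0}"
  have 0: "mp_eval h \<phi> 0 = 0"
    by (rule mp_eval_0) (fact h)+
  have add: "mp_eval h \<phi> (p + q) = mp_eval h \<phi> p + mp_eval h \<phi> q" for p q
    by (rule mp_eval_add) (fact h)+
  have diff: "mp_eval h \<phi> (p - q) = mp_eval h \<phi> p - mp_eval h \<phi> q" for p q
    by (rule mp_eval_diff) (fact h)+
  have mult: "mp_eval h \<phi> (p * q) = mp_eval h \<phi> p * mp_eval h \<phi> q" for p q
    by (rule mp_eval_mult) (fact h)+
  have const: "mp_eval h \<phi> (mp_const c) = h c" for c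
    by (rule mp_eval_const) (fact h)+
  have var: "mp_eval h \<phi> (mp_var w) = \<phi> w" for w
    by (rule mp_eval_var) (fact h)+
  have "ideal ?Z R"
  proof (rule idealI)
    show "subgroup ?Z (add_monoid R)"
    proof (rule R.add.subgroupI)
      fix a assume "a \<in> ?Z"
      then show "\<ominus>\<^bsub>R\<^esub> a \<in> ?Z"
        using diff[of 0 a] 0 R.a_inv_closed[of a] by (auto simp: mp_ring_minus)
    next
      fix a b assume "a \<in> ?Z" "b \<in> ?Z"
      then show "a \<oplus>\<^bsub>R\<^esub> b \<in> ?Z"
        by (auto simp: mp_ring_simps(4) add carrier_add)
    qed (use 0 R.zero_closed in \<open>auto simp: mp_ring_simps(5)\<close>)
  next
    fix a x assume "a \<in> ?Z" "x \<in> carrier R"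
    then show "x \<otimes>\<^bsub>R\<^esub> a \<in> ?Z" "a \<otimes>\<^bsub>R\<^esub> x \<in> ?Z"
      by (auto simp: mp_ring_simps(2) mult carrier_mult)
  qed (rule R.ring_axioms)
  moreover have "sym_relations scale W \<subseteq> ?Z"
    using sym_relations_closed[OF vector_space_axioms W]
    by (auto simp: sym_relations_def diff mult const var \<phi>)
  ultimately have "sym_ideal scale W \<subseteq> ?Z"
    unfolding sym_ideal_def by (rule R.genideal_minimal)
  then show ?thesis using p by blast
qed

text \<open>A vanishing combination in the quotient lifts, coefficient by coefficient, to a
  polynomial combination lying in \<open>sym_ideal\<close>.\<close>

lemma independent_proj:
  assumes ts: "distinct ts" and p: "\<And>t. t \<in> set ts \<Longrightarrow> p t \<in> carrier R"
    and indep: "\<And>c t. (\<Sum>t\<in>set ts. mp_const (c t) * p t) \<in> sym_ideal scale W \<Longrightarrow> t \<in> set ts \<Longrightarrow> c t = 0"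
  shows "S.independent scalars (map (\<lambda>t. proj (p t)) ts)"
proof (rule ccontr)
  let ?Us = "map (\<lambda>t. proj (p t)) ts"
  assume dep: "S.dependent scalars ?Us"
  have "set ?Us \<subseteq> carrier S"
    using p by auto
  then obtain Ks where Ks: "length Ks = length ?Us" "S.combine Ks ?Us = \<zero>\<^bsub>S\<^esub>"
      "set Ks \<subseteq> scalars" "set Ks \<noteq> {\<zero>\<^bsub>S\<^esub>}"
    by (rule S.dependent_imp_non_trivial_combine[OF scalars_subfield _ dep])
  obtain c where c: "Ks = map (\<lambda>t. proj (mp_const (c t))) ts"
    using ex_map_eq[OF ts, of Ks "\<lambda>c. proj (mp_const c)"] Ks(1,3) by (auto simp: scalars_eq)
  \<comment> \<open>Stated for all lists over \<open>set ts\<close>, so that the induction leaves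
    \<open>c\<close> and \<open>ts\<close> fixed.\<close>
  have "(\<Sum>t\<leftarrow>us. mp_const (c t) * p t) \<in> carrier R \<and>
      S.combine (map (\<lambda>t. proj (mp_const (c t))) us) (map (\<lambda>t. proj (p t)) us) =
      proj (\<Sum>t\<leftarrow>us. mp_const (c t) * p t)" if "set us \<subseteq> set ts" for us
    using that
  proof (induction us)
    case Nil
    show ?case
      using R.zero_closed proj.hom_zero by (simp add: mp_ring_simps(5))
  next
    case (Cons t us)
    then show ?case
      using p[of t] by (simp add: carrier_add carrier_mult mp_const_closed proj_add proj_mult)
  qed
  from this[of ts] have "(\<Sum>t\<in>set ts. mp_const (c t) * p t) \<in> sym_ideal scale W"
    using Ks(2) c proj_eq_zero_iff ts by (simp add: sum_list_distinct_conv_sum_set)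
  then have c0: "c t = 0" if "t \<in> set ts" for t
    using that by (rule indep)
  have "proj (mp_const 0) = \<zero>\<^bsub>S\<^esub>"
    using proj.hom_zero by (simp add: mp_const_0 mp_ring_simps(5))
  then have "set Ks \<subseteq> {\<zero>\<^bsub>S\<^esub>}"
    using c c0 by auto
  \<comment> \<open>All scalars vanish although their set is not the singleton of zero, so there are
    none; but the empty list is independent.\<close>
  then have "Ks = []"
    using Ks(4) by (metis set_empty subset_singletonD)
  then show False
    using dep Ks(1) by auto
qed

text \<open>A straightening argument: a product whose complement \<open>T\<close> is not saturated
  is rewritten by exchanging elements of \<open>T\<close> for a smaller one. Rank and size stay
  fixed while the sum of the elements drops.\<close>

lemma proj_prod_mem_Span:
  assumes \<alpha>: "\<And>i. i \<in> {1..n} \<Longrightarrow> \<alpha> i \<in> W" and Us: "set Us \<subseteq> carrier S"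
    and sat: "\<And>T. T \<in> saturated span {} \<alpha> n \<Longrightarrow> dim (\<alpha> ` T) = j \<Longrightarrow> card T = k \<Longrightarrow>
      proj (\<Prod>i\<in>{1..n} - T. mp_var (\<alpha> i)) \<in> S.Span scalars Us"
    and T: "T \<subseteq> {1..n}" "dim (\<alpha> ` T) = j" "card T = k"
  shows "proj (\<Prod>i\<in>{1..n} - T. mp_var (\<alpha> i)) \<in> S.Span scalars Us"
  using T
proof (induction "\<Sum>T" arbitrary: T rule: less_induct)
  case less
  note Span = S.Span_subgroup_props[OF scalars_subfield Us]
    S.Span_smult_closed[OF scalars_subfield Us]
  have finT: "finite T"
    using less.prems(1) finite_subset by blast
  show ?case
  proof (cases "T \<in> saturated span {} \<alpha> n")
    case True
    then show ?thesis using less.prems sat by blast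
  next
    case False
    then obtain e where e: "e \<in> {1..n}" "e \<notin> T" "\<alpha> e \<in> span (\<alpha> ` {b\<in>T. e < b})"
      using less.prems(1) by (auto simp: saturated_def)
    define P where "P X \<longleftrightarrow> X \<subseteq> {b\<in>T. e < b} \<and> \<alpha> e \<in> span (\<alpha> ` X)" for X
    have "P {b\<in>T. e < b}"
      using e(3) by (simp add: P_def)
    \<comment> \<open>Minimality of \<open>X\<close> makes every \<open>b\<close> in it essential
      for expressing \<open>\<alpha> e\<close>, so each can be exchanged for
      \<open>e\<close>.\<close>
    then obtain X where PX: "P X" and min: "\<And>Y. P Y \<Longrightarrow> card X \<le> card Y"
      using ex_has_least_nat[of P _ card] by blast
    then have X: "X \<subseteq> {b\<in>T. e < b}" "\<alpha> e \<in> span (\<alpha> ` X)"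
      by (simp_all add: P_def)
    have finX: "finite X"
      using X(1) finT finite_subset by fastforce
    let ?Q = "{1..n} - T - {e}"
    \<comment> \<open>The factor shared by the product for \<open>T\<close> and the products for all
      exchanged sets \<open>insert e (T - {b})\<close>.\<close>
    define q where "q = (\<Prod>i\<in>?Q. mp_var (\<alpha> i) :: ('b, 'a) mpoly)"
    have q: "q \<in> carrier R"
      unfolding q_def using \<alpha> by (intro carrier_prod mp_var_closed) auto
    have split: "proj (\<Prod>i\<in>insert x ?Q. mp_var (\<alpha> i)) = proj (mp_var (\<alpha> x)) \<otimes>\<^bsub>S\<^esub> proj q"
      if "x \<notin> ?Q" "\<alpha> x \<in> W" for x
    proof -
      have "(\<Prod>i\<in>insert x ?Q. mp_var (\<alpha> i)) = mp_var (\<alpha> x) * q"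
        unfolding q_def using that(1) by (intro prod.insert) auto
      then show ?thesis
        using that(2) q by (simp only: proj_mult mp_var_closed)
    qed
    define V where "V = {v \<in> W. proj (mp_var v) \<otimes>\<^bsub>S\<^esub> proj q \<in> S.Span scalars Us}"
    have pq: "proj q \<in> carrier S" "\<And>v. v \<in> W \<Longrightarrow> proj (mp_var v) \<in> carrier S"
      by (simp_all add: q mp_var_closed)
    have "subspace V"
      unfolding subspace_def
    proof (intro conjI ballI allI)
      fix u v assume "u \<in> V" "v \<in> V"
      then show "u + v \<in> V"
        using W pq by (simp add: V_def subspace_add proj_var_add S.l_distr Span(3) del: S.Span.simps)
    next
      fix c v assume v: "v \<in> V"
      have "proj (mp_const c) \<in> scalars" "proj (mp_const c) \<in> carrier S"
        by (simp_all add: scalars_eq mp_const_closed)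
      then show "scale c v \<in> V"
        using v W pq
        by (simp add: V_def subspace_scale proj_var_scale S.m_assoc Span(5) del: S.Span.simps)
    next
      have 0: "0 \<in> W" using W by (rule subspace_0)
      have "proj (mp_const 0) = \<zero>\<^bsub>S\<^esub>"
        using proj.hom_zero by (simp add: mp_const_0 mp_ring_simps(5))
      then have "proj (mp_var 0) = \<zero>\<^bsub>S\<^esub>"
        using proj_var_scale[OF 0, of 0] 0 pq by simp
      then show "0 \<in> V"
        using 0 pq Span(2) by (simp add: V_def del: S.Span.simps)
    qed
    moreover have "\<alpha> ` X \<subseteq> V"
    proof
      fix v assume "v \<in> \<alpha> ` X"
      then obtain b where b: "b \<in> X" "v = \<alpha> b" by blast
      have bT: "b \<in> T" "e < b" "b \<in> {1..n}"
        using b(1) X(1) less.prems(1) by auto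
      let ?T = "insert e (T - {b})"
      have "card (X - {b}) < card X"
        using finX b(1) by (rule card_Diff1_less)
      then have "\<alpha> e \<notin> span (\<alpha> ` (X - {b}))"
        using min[of "X - {b}"] X(1) by (auto simp: P_def)
      then have "\<alpha> e \<notin> span (\<alpha> ` X - {\<alpha> b})"
        using span_mono[of "\<alpha> ` X - {\<alpha> b}" "\<alpha> ` (X - {b})"] by blast
      \<comment> \<open>Steinitz exchange: \<open>\<alpha> b\<close> is needed to express
        \<open>\<alpha> e\<close>, hence can be solved for.\<close>
      then have "\<alpha> b \<in> span (insert (\<alpha> e) (\<alpha> ` X - {\<alpha> b}))"
        by (rule in_span_delete[OF X(2)])
      moreover have "insert (\<alpha> e) (\<alpha> ` X - {\<alpha> b}) \<subseteq> \<alpha> ` ?T"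
        using X(1) by blast
      ultimately have ab: "\<alpha> b \<in> span (\<alpha> ` ?T)"
        using span_mono by blast
      have ae: "\<alpha> e \<in> span (\<alpha> ` T)"
        using X span_mono[of "\<alpha> ` X" "\<alpha> ` T"] by blast
      have "span (\<alpha> ` ?T) = span (\<alpha> ` T)"
      proof (rule span_eq[THEN iffD2], intro conjI)
        show "\<alpha> ` ?T \<subseteq> span (\<alpha> ` T)"
          using ae span_superset[of "\<alpha> ` T"] by blast
        show "\<alpha> ` T \<subseteq> span (\<alpha> ` ?T)"
          using ab span_superset[of "\<alpha> ` ?T"] by blast
      qed
      then have "dim (\<alpha> ` ?T) = j"
        using less.prems(2) span_eq_dim by blast
      moreover have "card ?T = k"
        using less.prems(3) e(2) finT card.remove[OF finT bT(1)] by simp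
      moreover have "?T \<subseteq> {1..n}"
        using less.prems(1) e(1) by blast
      \<comment> \<open>The sum decreases because \<open>e < b\<close>, so the induction hypothesis
        covers the exchanged set.\<close>
      moreover have "\<Sum>?T < \<Sum>T"
        using e(2) bT finT sum.remove[OF finT bT(1), of "\<lambda>x. x"] by simp
      ultimately have "proj (\<Prod>i\<in>{1..n} - ?T. mp_var (\<alpha> i)) \<in> S.Span scalars Us"
        by (intro less.hyps)
      moreover have "{1..n} - ?T = insert b ?Q"
        using e(2) bT by auto
      moreover have "b \<notin> ?Q" "\<alpha> b \<in> W"
        using bT \<alpha> by auto
      ultimately show "v \<in> V"
        using b(2) split[of b] by (simp add: V_def del: S.Span.simps One_nat_def)
    qed
    ultimately have "\<alpha> e \<in> V"
      using X(2) span_minimal by blast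
    moreover have "{1..n} - T = insert e ?Q"
      using e by auto
    ultimately show ?thesis
      using split[of e] by (simp add: V_def del: S.Span.simps One_nat_def)
  qed
qed

text \<open>The products over complements of saturated sets of rank \<open>j\<close> and size
  \<open>k\<close> form a basis: straightening shows that they span, and injective coordinates
  \<psi> carry them to polynomials known to be independent.\<close>

lemma dim_linear_span_products:
  fixes \<psi> :: "'b \<Rightarrow> nat \<Rightarrow> 'a"
  assumes \<alpha>: "\<And>i. i \<in> {1..n} \<Longrightarrow> \<alpha> i \<in> W"
    and \<psi>: "\<And>u v i. \<psi> (u + v) i = \<psi> u i + \<psi> v i" "\<And>k v i. \<psi> (scale k v) i = k * \<psi> v i"
    and inj: "\<And>v. v \<in> W \<Longrightarrow> \<forall>i<l. \<psi> v i = 0 \<Longrightarrow> v = 0"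
  shows "ring.dim S scalars (linear_span S scalars
      {proj (\<Prod>i\<in>A. mp_var (\<alpha> i)) | A. A \<subseteq> {1..n} \<and> dim (\<alpha> ` ({1..n} - A)) = j \<and> card ({1..n} - A) = k}) =
    card {T \<in> saturated span {} \<alpha> n. dim (\<alpha> ` T) = j \<and> card T = k}"
    (is "ring.dim S scalars (linear_span S scalars ?F) = card ?G")
proof -
  let ?p = "\<lambda>T. \<Prod>i\<in>{1..n} - T. mp_var (\<alpha> i)"
  have finG: "finite ?G"
    by (intro finite_subset[OF _ finite_saturated[of span "{}" \<alpha> n]]) auto
  then obtain ts where ts: "set ts = ?G" "distinct ts"
    using finite_distinct_list by blast
  let ?Us = "map (\<lambda>T. proj (?p T)) ts"
  have p: "?p T \<in> carrier R" for T
    using \<alpha> by (intro carrier_prod mp_var_closed) auto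
  have sub: "T \<subseteq> {1..n}" if "T \<in> saturated span {} \<alpha> n" for T
    using that by (auto simp: saturated_def)
  have "S.independent scalars ?Us"
  proof (rule independent_proj[OF ts(2)])
    fix c :: "nat set \<Rightarrow> 'a" and T
    assume mem: "(\<Sum>T\<in>set ts. mp_const (c T) * ?p T) \<in> sym_ideal scale W" and T: "T \<in> set ts"
    let ?\<phi> = "\<lambda>v. lin_poly l (\<psi> v)"
    \<comment> \<open>Coefficients are extended by zero, since the independence result concerns
      saturated sets of all ranks and sizes.\<close>
    let ?c = "\<lambda>T. if T \<in> ?G then c T else 0"
    note hom = mp_const_0 mp_const_1 mp_const_add mp_const_mult
    have "mp_eval mp_const ?\<phi> (\<Sum>T\<in>set ts. mp_const (c T) * ?p T) = 0"
    proof (rule mp_eval_sym_ideal[OF hom _ _ mem])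
      show "?\<phi> (u + w) = ?\<phi> u + ?\<phi> w" for u w
        by (simp add: lin_poly_add[symmetric] \<psi>(1)[abs_def])
      show "?\<phi> (scale c w) = mp_const c * ?\<phi> w" for c w
        by (simp add: lin_poly_scale[symmetric] \<psi>(2)[abs_def])
    qed
    then have "(\<Sum>T\<in>?G. mp_const (c T) * (\<Prod>i\<in>{1..n} - T. ?\<phi> (\<alpha> i))) = 0"
      unfolding ts(1)
      by (simp add: mp_eval_sum[OF hom] mp_eval_mult[OF hom] mp_eval_const[OF hom]
          mp_eval_prod[OF hom] mp_eval_var[OF hom])
    moreover have "(\<Sum>T\<in>saturated span {} \<alpha> n. mp_const (?c T) * (\<Prod>i\<in>{1..n} - T. ?\<phi> (\<alpha> i))) =
        (\<Sum>T\<in>?G. mp_const (c T) * (\<Prod>i\<in>{1..n} - T. ?\<phi> (\<alpha> i)))"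
      by (intro sum.mono_neutral_cong_right) (auto simp: finite_saturated mp_const_0)
    ultimately have sum0: "(\<Sum>T\<in>saturated span {} \<alpha> n.
        mp_const (?c T) * (\<Prod>i\<in>{1..n} - T. ?\<phi> (\<alpha> i))) = 0"
      by simp
    have "?c T = 0"
    proof (rule saturated_products_independent[OF W _ \<alpha> \<psi> _ sum0])
      have "\<psi> 0 i = 0" for i
        using \<psi>(2)[of 0 0 i] by simp
      then show "(\<forall>i<l. \<psi> v i = 0) \<longleftrightarrow> v \<in> span {}" if "v \<in> W" for v
        using inj[OF that] by auto
    qed (use T ts in auto)
    then show "c T = 0"
      using T ts(1) by simp
  qed (rule p)
  then have "S.dimension (length ?Us) scalars (S.Span scalars ?Us)"
    by (rule S.dimension_independent)
  moreover have "linear_span S scalars ?F = S.Span scalars ?Us"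
  proof (rule S.linear_span_eq_Span[OF scalars_subfield])
    show carr: "set ?Us \<subseteq> carrier S"
      using p by auto
    show "set ?Us \<subseteq> ?F"
    proof
      fix x assume "x \<in> set ?Us"
      then obtain T where T: "T \<in> ?G" "x = proj (?p T)"
        using ts(1) by auto
      then have "{1..n} - ({1..n} - T) = T"
        using sub by blast
      then show "x \<in> ?F"
        using T by (intro CollectI exI[of _ "{1..n} - T"]) auto
    qed
    show "?F \<subseteq> S.Span scalars ?Us"
    proof
      fix x assume "x \<in> ?F"
      then obtain A where A: "A \<subseteq> {1..n}" "dim (\<alpha> ` ({1..n} - A)) = j" "card ({1..n} - A) = k"
          "x = proj (\<Prod>i\<in>A. mp_var (\<alpha> i))"
        by blast
      have "{1..n} - ({1..n} - A) = A"
        using A(1) by blast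
      moreover have "proj (?p ({1..n} - A)) \<in> S.Span scalars ?Us"
      proof (rule proj_prod_mem_Span[OF \<alpha> carr _ _ A(2,3)])
        fix T assume "T \<in> saturated span {} \<alpha> n" "dim (\<alpha> ` T) = j" "card T = k"
        then have "proj (?p T) \<in> set ?Us"
          using ts(1) by auto
        then show "proj (?p T) \<in> S.Span scalars ?Us"
          using S.Span_base_incl[OF scalars_subfield carr] by blast
      qed auto
      ultimately show "x \<in> S.Span scalars ?Us"
        using A(4) by simp
    qed
  qed
  ultimately have "(ring.dim S over scalars) (linear_span S scalars ?F) = length ?Us"
    using S.dimI[OF scalars_subfield] by simp
  then show ?thesis
    using ts by (simp add: over_def distinct_card[symmetric])
qed

end


section \<open>Forms on a finite-dimensional space\<close>

text \<open>The coordinate functionals of \<open>B\<close> form the dual basis.\<close>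

lemma dim_dual_space:
  fixes scale :: "'k::field \<Rightarrow> 'v::ab_group_add \<Rightarrow> 'v"
  assumes "finite_dimensional_vector_space scale B"
  shows "fun_vs.dim (dual_space scale) = card B"
proof -
  interpret V: finite_dimensional_vector_space scale B by (rule assms)
  interpret K: vector_space "(*) :: 'k \<Rightarrow> 'k \<Rightarrow> 'k"
    by unfold_locales (auto simp: algebra_simps)
  have rep: "Vector_Spaces.linear scale (*) (\<lambda>v. V.representation B v b)" for b
    by (simp add: Vector_Spaces.linear_def module_hom_iff V.vector_space_axioms
        V.module_axioms K.vector_space_axioms K.module_axioms
        V.representation_add V.representation_scale V.independent_Basis V.span_Basis)
  define c where "c b v = V.representation B v b" for b v
  have c_basis: "c b b' = (if b = b' then 1 else 0)" if "b' \<in> B" for b b'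
    by (simp add: c_def V.representation_basis[OF V.independent_Basis that])
  have inj: "inj_on c B"
    by (intro inj_onI) (metis c_basis zero_neq_one)
  have sum_eval: "(\<Sum>b\<in>B. fun_scale (u b) (c b)) v = (\<Sum>b\<in>B. u b * c b v)" for u v
    by (induction B rule: infinite_finite_induct) (simp_all add: fun_scale_def)
  have "fun_vs.independent (c ` B)"
  proof (rule fun_vs.independent_if_scalars_zero)
    fix u x assume "(\<Sum>x\<in>c ` B. fun_scale (u x) x) = 0" and x: "x \<in> c ` B"
    then have *: "(\<Sum>b\<in>B. fun_scale (u (c b)) (c b)) = 0"
      by (simp add: sum.reindex[OF inj])
    obtain b where b: "b \<in> B" "x = c b" using x by blast
    have "(\<Sum>b'\<in>B. u (c b') * c b' b) = 0"
      using fun_cong[OF *, of b] sum_eval[of "\<lambda>b. u (c b)" b] by simp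
    then show "u x = 0"
      using b by (simp add: c_basis if_distrib V.finite_Basis cong: if_cong)
  qed (simp add: V.finite_Basis)
  moreover have "c ` B \<subseteq> dual_space scale"
    using rep by (auto simp: dual_space_def c_def[abs_def])
  moreover have "dual_space scale \<subseteq> fun_vs.span (c ` B)"
  proof
    fix f assume "f \<in> dual_space scale"
    then interpret f: Vector_Spaces.linear scale "(*)" f
      by (simp add: dual_space_def)
    have "f = (\<Sum>b\<in>B. fun_scale (f b) (c b))"
    proof
      fix v
      have "f v = f (\<Sum>b\<in>B. scale (c b v) b)"
        unfolding c_def
        by (subst V.sum_representation_eq)
          (simp_all add: V.independent_Basis V.span_Basis V.finite_Basis)
      also have "\<dots> = (\<Sum>b\<in>B. f b * c b v)"
        by (simp add: f.sum f.scale mult.commute)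
      finally show "f v = (\<Sum>b\<in>B. fun_scale (f b) (c b)) v"
        by (simp add: sum_eval)
    qed
    also have "\<dots> \<in> fun_vs.span (c ` B)"
      by (intro fun_vs.span_sum fun_vs.span_scale fun_vs.span_base) auto
    finally show "f \<in> fun_vs.span (c ` B)" .
  qed
  ultimately have "card (c ` B) = fun_vs.dim (dual_space scale)"
    by (intro fun_vs.basis_card_eq_dim)
  then show ?thesis
    by (simp add: card_image[OF inj])
qed

lemma P_dim_eq_card_saturated:
  fixes scale :: "'k::field \<Rightarrow> 'v::ab_group_add \<Rightarrow> 'v"
  assumes fd: "finite_dimensional_vector_space scale B"
    and \<alpha>: "\<forall>i\<in>{1..n}. \<alpha> i \<in> dual_space scale"
  shows "P_dim scale n \<alpha> j k =
    card {T \<in> saturated fun_vs.span {} \<alpha> n. form_rank \<alpha> T = j \<and> card T = k}"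
proof -
  interpret V: finite_dimensional_vector_space scale B by (rule fd)
  interpret D: sym_algebra "fun_scale :: 'k \<Rightarrow> ('v \<Rightarrow> 'k) \<Rightarrow> _" "dual_space scale"
    by (intro sym_algebra.intro sym_algebra_axioms.intro fun_vs.vector_space_axioms
        dual_space_subspace V.vector_space_axioms)
  obtain \<beta> where \<beta>: "bij_betw \<beta> {0..<card B} B"
    using ex_bij_betw_nat_finite[OF V.finite_Basis] by blast
  \<comment> \<open>The coordinates of a form are its values on the basis \<open>B\<close>; they
    determine it.\<close>
  define \<psi> where "\<psi> v i = v (\<beta> i)" for v :: "'v \<Rightarrow> 'k" and i :: nat
  have prod: "form_prod scale \<alpha> S = D.proj (\<Prod>i\<in>S. mp_var (\<alpha> i))" if "S \<subseteq> {1..n}" for S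
    unfolding form_prod_def using that \<alpha> finite_subset
    by (intro D.finprod_sym_inc) auto
  have "P_dim scale n \<alpha> j k = ring.dim (Sym fun_scale (dual_space scale))
      (sym_scalars fun_scale (dual_space scale))
      (linear_span (Sym fun_scale (dual_space scale)) (sym_scalars fun_scale (dual_space scale))
        {D.proj (\<Prod>i\<in>S. mp_var (\<alpha> i)) | S.
          S \<subseteq> {1..n} \<and> fun_vs.dim (\<alpha> ` ({1..n} - S)) = j \<and> card ({1..n} - S) = k})"
    unfolding P_dim_def P_space_def form_rank_def fun_vs.dim_span
    using prod by (intro arg_cong[of _ _ "\<lambda>F. ring.dim _ _ (linear_span _ _ F)"]) blast
  also have "\<dots> = card {T \<in> saturated fun_vs.span {} \<alpha> n. fun_vs.dim (\<alpha> ` T) = j \<and> card T = k}"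
  proof (rule D.dim_linear_span_products)
    show "\<psi> (u + v) i = \<psi> u i + \<psi> v i" "\<psi> (fun_scale c v) i = c * \<psi> v i" for u v i c
      by (simp_all add: \<psi>_def fun_scale_def)
    show "v = 0" if v: "v \<in> dual_space scale" "\<forall>i<card B. \<psi> v i = 0" for v
    proof
      interpret v: Vector_Spaces.linear scale "(*)" v
        using v(1) by (simp add: dual_space_def)
      have zero: "v b = 0" if b: "b \<in> B" for b
      proof -
        obtain i where "i < card B" "b = \<beta> i"
          using \<beta> b by (metis atLeastLessThan_iff bij_betw_iff_bijections)
        then show ?thesis using v(2) by (simp add: \<psi>_def)
      qed
      fix x
      have "x \<in> V.span B" by (simp add: V.span_Basis)
      then show "v x = 0 x"
        by (induction rule: V.span_induct_alt) (simp_all add: v.zero v.add v.scale zero)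
    qed
  qed (use \<alpha> in auto)
  finally show ?thesis
    by (simp add: form_rank_def)
qed

theorem theorem1p1:
  fixes scale :: "'k::field \<Rightarrow> 'v::ab_group_add \<Rightarrow> 'v"
    and B :: "'v set"
    and \<alpha> :: "nat \<Rightarrow> 'v \<Rightarrow> 'k"
    and n l :: nat
  assumes "finite_dimensional_vector_space scale B"
    and "vector_space.dim scale (UNIV :: 'v set) = l"
    and "\<forall>i\<in>{1..n}. \<alpha> i \<in> dual_space scale"
    and "fun_vs.span (\<alpha> ` {1..n}) = dual_space scale"
  shows "tutte_poly {1..n} (form_rank \<alpha>) =
    (\<Sum>(j, k)\<in>{(j, k). j \<le> k \<and> k \<le> n}.
       (poly_x - 1) ^ (l - j) * poly_y ^ (k - j) * of_nat (P_dim scale n \<alpha> j k))"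
proof -
  interpret M: matroid_rank "{1..n}" "form_rank \<alpha>"
    by (rule matroid_form_rank)
  let ?G = "saturated fun_vs.span {} \<alpha> n"
  let ?JK = "{(j, k). j \<le> k \<and> k \<le> n}"
  have rank: "form_rank \<alpha> T = fun_vs.dim (\<alpha> ` T)" for T
    by (simp add: form_rank_def)
  \<comment> \<open>The forms span the dual space, whose dimension is that of the space
    itself.\<close>
  have l: "form_rank \<alpha> {1..n} = l"
    using assms(2,4) dim_dual_space[OF assms(1)]
      finite_dimensional_vector_space.dim_UNIV[OF assms(1)] by (simp add: form_rank_def)
  have sub: "T \<subseteq> {1..n}" if "T \<in> ?G" for T
    using that by (auto simp: saturated_def)
  have "fun_vs.dim ({} :: ('v \<Rightarrow> 'k) set) = 0"
    using fun_vs.dim_eq_card_independent[OF fun_vs.independent_empty] by simp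
  then have "tutte_poly {1..n} (form_rank \<alpha>) =
      (\<Sum>T\<in>?G. (poly_x - 1) ^ (l - form_rank \<alpha> T) * poly_y ^ (card T - form_rank \<alpha> T))"
    using fun_vs.sum_Pow_eq_sum_saturated[of "{}" "\<lambda>r. (poly_x - 1) ^ (l - r)" \<alpha> poly_y n]
    unfolding tutte_poly_def l by (simp add: rank)
  \<comment> \<open>The saturated sets are grouped by rank and size; rank is at most size, and size
    at most \<open>n\<close>.\<close>
  also have "\<dots> = (\<Sum>(j, k)\<in>?JK. \<Sum>T\<in>{T \<in> ?G. (form_rank \<alpha> T, card T) = (j, k)}.
      (poly_x - 1) ^ (l - form_rank \<alpha> T) * poly_y ^ (card T - form_rank \<alpha> T))"
    unfolding case_prod_eta[of "\<lambda>jk. \<Sum>T\<in>{T \<in> ?G. (form_rank \<alpha> T, card T) = jk}. _ T"]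
  proof (subst sum.group)
    show "finite ?JK"
      by (rule finite_subset[of _ "{..n} \<times> {..n}"]) auto
    show "(\<lambda>T. (form_rank \<alpha> T, card T)) ` ?G \<subseteq> ?JK"
      using sub M.rank_le_card card_mono[of "{1..n}"] by fastforce
  qed (simp_all add: finite_saturated)
  \<comment> \<open>The summand is constant on each group, and the group has as many members as the
    dimension \<open>P_dim\<close>.\<close>
  also have "\<dots> = (\<Sum>(j, k)\<in>?JK.
      (poly_x - 1) ^ (l - j) * poly_y ^ (k - j) * of_nat (P_dim scale n \<alpha> j k))"
    by (intro sum.cong refl)
      (auto simp: P_dim_eq_card_saturated[OF assms(1,3)] mult.commute)
  finally show ?thesis .
qed

end
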